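(* (i) If $d\in\{1,2\}$, then the collection $\mathcal{T}_d=\{A\cdot\mathcal{C}_d: A\in\mathrm{PSL}(2,\mathbb{Z}[\omega_d])\}$ forms a tessellation of $\mathbb{H}^3$. (ii) If $d\in\{3,7,11\}$, then the collection $\mathcal{T}_d=\{A\cdot\mathcal{C}_d: A\in\mathrm{PSL}(2,\mathbb{Z}[\omega_d])\}\cup\{A\cdot\mathcal{C}'_d: A\in\mathrm{PSL}(2,\mathbb{Z}[\omega_d])\}$ forms a tessellation of $\mathbb{H}^3$.
   Context: $\omega_d=\sqrt{-d}$ for $d\in\{1,2\}$, $\omega_d=\frac{1+\sqrt{-d}}2$ for $d\in\{3,7,11\}$. $\mathbb{H}^3=\{x_1+x_2i+x_3j: x_1,x_2,x_3\in\mathbb{R},\ x_3>0\}\cong\mathbb{C}\times\mathbb{R}_{>0}$ (quaternion notation), with boundary $\mathbb{C}\cup\{\infty\}$. $A=\begin{pmatrix}a&b\\c&e\end{pmatrix}\in\mathrm{SL}(2,\mathbb{Z}[\omega_d])$ acts on $\mathbb{H}^3$ by $A(w)=(aw+b)(cw+e)^{-1}$ (quaternion arithmetic), giving the action of $\mathrm{PSL}(2,\mathbb{Z}[\omega_d])=\mathrm{SL}(2,\mathbb{Z}[\omega_d])/\{\pm I\}$; $A\cdot M=\{A(w):w\in M\}$. Let $W_d\subset\mathbb{C}$ be the rectangle with corners $0,1,\omega_d,\omega_d+1$ if $d\in\{1,2\}$ and the triangle with corners $0,1,\omega_d$ if $d\in\{3,7,11\}$. A wall is the vertical half-plane $\{(z,t):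 z\in L,\ t>0\}$ (together with its boundary line) over the line $L\subset\mathbb{C}$ containing an edge of $W_d$. Images $A\cdot X$ of walls are hemispheres orthogonal to $\mathbb{C}$ or vertical half-planes. The standard cell $\mathcal{C}_d$ is the closure of the set of all points of $W_d\times\mathbb{R}_{>0}$ that lie above (i.e. outside the half-balls bounded by) the union of all non-degenerate spheres (hemispheres) of the form $A\cdot X$ with $A\in\mathrm{PSL}(2,\mathbb{Z}[\omega_d])$ and $X$ a wall. Further $\mathcal{C}'_d=\{(\overline z,y):(z,y)\in\mathcal{C}_d\}$. A collection of closed sets forms a tessellation of $\mathbb{H}^3$ if its union is $\mathbb{H}^3$ and any two members have either equal or disjoint interiors. *)

theory Defs
  imports "HOL-Analysis.Analysis"
begin

text \<open>Quaternions: the pair \<open>(p, q)\<close> of complex numbers stands for \<open>p + q j\<close>, where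
  \<open>j q = cnj q j\<close> and \<open>j j = - 1\<close>.\<close>

type_synonym quat = "complex \<times> complex"

definition quat_of_complex :: "complex \<Rightarrow> quat" where
  "quat_of_complex p = (p, 0)"

definition quat_add :: "quat \<Rightarrow> quat \<Rightarrow> quat" where
  "quat_add x y = (fst x + fst y, snd x + snd y)"

definition quat_mult :: "quat \<Rightarrow> quat \<Rightarrow> quat" where
  "quat_mult x y =
     (fst x * fst y - snd x * cnj (snd y), fst x * snd y + snd x * cnj (fst y))"

definition quat_inverse :: "quat \<Rightarrow> quat" where
  "quat_inverse x =
     (let n = complex_of_real ((cmod (fst x))\<^sup>2 + (cmod (snd x))\<^sup>2)
      in (cnj (fst x) / n, - snd x / n))"

lemma quat_mult_assoc: "quat_mult (quat_mult x y) z = quat_mult x (quat_mult y z)"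
  by (simp add: quat_mult_def algebra_simps)

lemma quat_mult_inverse:
  assumes "x \<noteq> (0, 0)"
  shows "quat_mult x (quat_inverse x) = (1, 0)" "quat_mult (quat_inverse x) x = (1, 0)"
proof -
  obtain p q where x: "x = (p, q)" by (cases x)
  define n where "n = complex_of_real ((cmod p)\<^sup>2 + (cmod q)\<^sup>2)"
  have "(cmod p)\<^sup>2 + (cmod q)\<^sup>2 \<noteq> 0"
    using assms x by (simp add: sum_power2_eq_zero_iff)
  then have n0: "n \<noteq> 0" by (simp only: n_def of_real_eq_0_iff not_False_eq_True)
  have cn: "cnj n = n" by (simp add: n_def)
  have n: "p * cnj p + q * cnj q = n"
    by (simp only: n_def of_real_add complex_norm_square)
  have i: "quat_inverse (p, q) = (cnj p / n, - q / n)"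
    by (simp add: quat_inverse_def n_def Let_def)
  show "quat_mult x (quat_inverse x) = (1, 0)" "quat_mult (quat_inverse x) x = (1, 0)"
    using n n0
    by (simp_all add: x i quat_mult_def cn mult.commute flip: add_divide_distrib)
qed

type_synonym point3 = "complex \<times> real"

definition H3 :: "point3 set" where
  "H3 = {w. 0 < snd w}"

definition quat_of_point :: "point3 \<Rightarrow> quat" where
  "quat_of_point w = (fst w, complex_of_real (snd w))"

definition moebius_quat :: "complex^2^2 \<Rightarrow> point3 \<Rightarrow> quat" where
  "moebius_quat A w =
     (let lin = (\<lambda>p q. quat_add (quat_mult (quat_of_complex p) (quat_of_point w)) (quat_of_complex q))
      in quat_mult (lin (A $ 1 $ 1) (A $ 1 $ 2)) (quat_inverse (lin (A $ 2 $ 1) (A $ 2 $ 2))))"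

text \<open>If \<open>det A = 1\<close> and \<open>w \<in> H3\<close>, the coefficient of \<open>j\<close> in \<open>moebius_quat A w\<close> is a
  positive real, so taking its real part loses nothing (see \<open>moebius_quat_eq\<close>).\<close>

definition moebius :: "complex^2^2 \<Rightarrow> point3 \<Rightarrow> point3" where
  "moebius A w = (fst (moebius_quat A w), Re (snd (moebius_quat A w)))"

lemma moebius_quat_eq:
  assumes "det A = 1" "w \<in> H3"
  shows "moebius A w \<in> H3" "quat_of_point (moebius A w) = moebius_quat A w"
proof -
  obtain z t where w: "w = (z, t)" by (cases w)
  have t: "0 < t" using assms(2) by (simp add: H3_def w)
  define a b c e where abce: "a = A $ 1 $ 1" "b = A $ 1 $ 2" "c = A $ 2 $ 1" "e = A $ 2 $ 2"
  have d: "a * e - b * c = 1" using assms(1) by (simp add: det_2 abce)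
  define n where "n = (cmod (c * z + e))\<^sup>2 + (cmod (c * of_real t))\<^sup>2"
  have "n \<noteq> 0"
  proof
    assume "n = 0"
    then have "c * z + e = 0" "c = 0" using t by (auto simp: n_def sum_power2_eq_zero_iff)
    then show False using d by simp
  qed
  then have n: "0 < n" by (simp add: n_def order_less_le)
  have nc: "(complex_of_real (cmod (c * z + e)))\<^sup>2 + (complex_of_real (cmod (c * of_real t)))\<^sup>2
      = of_real n"
    by (simp only: n_def of_real_add of_real_power)
  have "snd (moebius_quat A w) = (a * e - b * c) * of_real t / of_real n"
    by (simp add: moebius_quat_def Let_def quat_mult_def quat_add_def quat_of_complex_def
        quat_of_point_def quat_inverse_def w abce[symmetric] nc
        add_divide_distrib[symmetric] diff_divide_distrib[symmetric])
       (simp add: algebra_simps)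
  then have s: "snd (moebius_quat A w) = of_real (t / n)" using d by simp
  show "moebius A w \<in> H3" using s t n by (simp add: moebius_def H3_def)
  show "quat_of_point (moebius A w) = moebius_quat A w"
    using s by (simp add: quat_of_point_def moebius_def prod_eq_iff)
qed

lemma moebius_uminus: "moebius (- A) w = moebius A w"
proof -
  have m: "cmod (- p - q) = cmod (p + q)" for p q :: complex
    by (metis minus_add_distrib norm_minus_cancel uminus_add_conv_diff add.commute)
  show ?thesis
    by (simp add: moebius_def moebius_quat_def Let_def quat_mult_def quat_add_def
        quat_of_complex_def quat_of_point_def quat_inverse_def m norm_mult)
       (simp add: algebra_simps diff_divide_distrib add_divide_distrib)
qed

definition omega :: "nat \<Rightarrow> complex" where
  "omega d = (if d \<in> {1, 2} then \<i> * sqrt (real d) else (1 + \<i> * sqrt (real d)) / 2)"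

definition Z_omega :: "nat \<Rightarrow> complex set" where
  "Z_omega d = {of_int m + of_int n * omega d | m n :: int. True}"

definition SL2 :: "nat \<Rightarrow> (complex^2^2) set" where
  "SL2 d = {A. (\<forall>i j. A $ i $ j \<in> Z_omega d) \<and> det A = 1}"

definition PSL2 :: "nat \<Rightarrow> (complex^2^2) set set" where
  "PSL2 d = SL2 d // {(A, B). A \<in> SL2 d \<and> B \<in> SL2 d \<and> (B = A \<or> B = - A)}"

definition psl_act :: "(complex^2^2) set \<Rightarrow> point3 \<Rightarrow> point3" where
  "psl_act P w = the_elem ((\<lambda>A. moebius A w) ` P)"

lemma uminus_SL2:
  assumes "A \<in> SL2 d"
  shows "- A \<in> SL2 d"
proof -
  have "- x \<in> Z_omega d" if x: "x \<in> Z_omega d" for x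
  proof -
    obtain m n :: int where "x = of_int m + of_int n * omega d"
      using x by (auto simp: Z_omega_def)
    then have "- x = of_int (- m) + of_int (- n) * omega d" by simp
    then show ?thesis unfolding Z_omega_def by blast
  qed
  then show ?thesis using assms by (simp add: SL2_def det_2)
qed

lemma PSL2_eq: "PSL2 d = (\<lambda>A. {A, - A}) ` SL2 d"
  by (auto simp: PSL2_def quotient_def uminus_SL2 image_iff)

lemma psl_act_class: "psl_act {A, - A} w = moebius A w"
  by (simp add: psl_act_def moebius_uminus)

definition base_polygon :: "nat \<Rightarrow> complex set" where
  "base_polygon d =
     (if d \<in> {1, 2} then convex hull {0, 1, omega d, omega d + 1}
      else convex hull {0, 1, omega d})"

definition edge_lines :: "nat \<Rightarrow> complex set set" where
  "edge_lines d =
     (if d \<in> {1, 2}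
      then {affine hull {0, 1}, affine hull {1, omega d + 1},
            affine hull {omega d, omega d + 1}, affine hull {0, omega d}}
      else {affine hull {0, 1}, affine hull {1, omega d}, affine hull {0, omega d}})"

text \<open>Walls and hemispheres are represented by their part inside \<open>H3\<close>, where the group acts;
  their boundary lines and circles lie outside \<open>H3\<close>.\<close>

definition walls :: "nat \<Rightarrow> point3 set set" where
  "walls d = (\<lambda>L. L \<times> {0<..}) ` edge_lines d"

definition hemisphere :: "complex \<Rightarrow> real \<Rightarrow> point3 set" where
  "hemisphere c r = sphere (c, 0) r \<inter> H3"

definition above_hemispheres :: "nat \<Rightarrow> point3 set" where
  "above_hemispheres d =
     {w \<in> H3. \<forall>P\<in>PSL2 d. \<forall>X\<in>walls d. \<forall>c r.
        0 < r \<and> psl_act P ` X = hemisphere c r \<longrightarrow> w \<notin> cball (c, 0) r}"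

definition std_cell :: "nat \<Rightarrow> point3 set" where
  "std_cell d =
     top_of_set H3 closure_of (base_polygon d \<times> {0<..} \<inter> above_hemispheres d)"

definition conj_cell :: "nat \<Rightarrow> point3 set" where
  "conj_cell d = (\<lambda>(z, y). (cnj z, y)) ` std_cell d"

definition tessellation :: "point3 set set \<Rightarrow> bool" where
  "tessellation \<T> \<longleftrightarrow>
     (\<forall>S\<in>\<T>. closedin (top_of_set H3) S) \<and> \<Union>\<T> = H3 \<and>
     (\<forall>S\<in>\<T>. \<forall>T\<in>\<T>.
        top_of_set H3 interior_of S = top_of_set H3 interior_of T \<or>
        disjnt (top_of_set H3 interior_of S) (top_of_set H3 interior_of T))"

end

theory Submission
  imports Defs
begin

text \<open>Every image of a wall is the zero set of a real function on \<open>H3\<close>, namely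
  \<open>w \<mapsto> Im (cnj \<delta> * fst (A w))\<close> with \<open>\<delta>\<close> an edge direction; up to a positive factor it is a form
  \<open>p (|z|^2 + t^2) + Im (B z) + q\<close> with \<open>B\<close> in \<open>Z_omega d\<close>, with \<open>p, q\<close> in \<open>Im (Z_omega d)\<close>, and with
  \<open>|B|^2 - 4 p q = |\<delta>|^2\<close>. This family of functions is invariant under the group and under complex
  conjugation.

  The standard cell is cut out by such functions, and none of them changes sign on it: the
  hemispheres (\<open>p \<noteq> 0\<close>) do not by construction, and the vertical planes (\<open>p = 0\<close>) do not because the
  norm equation \<open>|B|^2 = |\<delta>|^2\<close> leaves only the lines of the lattice tiling by the base polygon. Hence
  at a common interior point two cells of the orbit see the same signs, so they are equal.

  For the covering, move a point to the greatest height in its orbit and translate it over the base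
  polygon or its conjugate. Then it lies outside all unit balls around lattice points, which
  forces it above every hemisphere.\<close>

subsection \<open>The Moebius action\<close>

lemma quat_mult_one [simp]: "quat_mult (1, 0) x = x" "quat_mult x (1, 0) = x"
  by (simp_all add: quat_mult_def)

lemma quat_inverse_unique:
  assumes "quat_mult x y = (1, 0)"
  shows "quat_inverse x = y"
proof -
  have "x \<noteq> (0, 0)" using assms by (auto simp: quat_mult_def)
  then have "quat_mult (quat_mult (quat_inverse x) x) y = y"
    by (simp add: quat_mult_inverse)
  then show ?thesis by (simp add: quat_mult_assoc assms)
qed

text \<open>A common right factor cancels from a quaternion fraction. This is what makes fractional
  linear maps compose although multiplication is not commutative.\<close>

lemma quat_fraction_cancel:
  assumes "x \<noteq> (0, 0)" "z \<noteq> (0, 0)"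
  shows "quat_mult (quat_mult y (quat_inverse z)) (quat_inverse (quat_mult x (quat_inverse z)))
    = quat_mult y (quat_inverse x)"
proof -
  have c: "quat_mult (quat_inverse z) (quat_mult z u) = u" for u
    using assms(2) by (simp add: quat_mult_inverse flip: quat_mult_assoc)
  have "quat_inverse (quat_mult x (quat_inverse z)) = quat_mult z (quat_inverse x)"
    by (rule quat_inverse_unique) (simp add: quat_mult_assoc c quat_mult_inverse assms)
  then show ?thesis by (simp add: quat_mult_assoc c)
qed

definition quat_lin :: "complex \<Rightarrow> complex \<Rightarrow> point3 \<Rightarrow> quat" where
  "quat_lin p q w = quat_add (quat_mult (quat_of_complex p) (quat_of_point w)) (quat_of_complex q)"

lemma moebius_quat_lin:
  "moebius_quat A w =
     quat_mult (quat_lin (A $ 1 $ 1) (A $ 1 $ 2) w) (quat_inverse (quat_lin (A $ 2 $ 1) (A $ 2 $ 2) w))"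
  by (simp add: moebius_quat_def quat_lin_def Let_def)

lemma quat_lin_Pair: "quat_lin p q (z, t) = (p * z + q, p * of_real t)"
  by (simp add: quat_lin_def quat_add_def quat_mult_def quat_of_complex_def quat_of_point_def)

lemma quat_lin_nonzero:
  fixes A :: "complex^2^2"
  assumes "det A = 1" "w \<in> H3"
  shows "quat_lin (A $ 2 $ 1) (A $ 2 $ 2) w \<noteq> (0, 0)"
  using assms by (cases w) (auto simp: quat_lin_Pair H3_def det_2)

text \<open>Writing \<open>B w\<close> as \<open>x y^-1\<close>, one gets
  \<open>p (B w) + q = (p x + q y) y^-1\<close> for complex \<open>p, q\<close>. Numerator and
  denominator of \<open>A (B w)\<close> thus share the right factor \<open>y^-1\<close>, which
  cancels.\<close>

lemma moebius_mult:
  assumes A: "det A = 1" and B: "det B = 1" and w: "w \<in> H3"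
  shows "moebius (A ** B) w = moebius A (moebius B w)"
proof -
  define x y where xy: "x = quat_lin (B $ 1 $ 1) (B $ 1 $ 2) w" "y = quat_lin (B $ 2 $ 1) (B $ 2 $ 2) w"
  have y0: "y \<noteq> (0, 0)" using quat_lin_nonzero[OF B w] by (simp add: xy)
  have AB: "det (A ** B) = 1" using A B by (simp add: det_mul)
  have lin: "quat_lin p q (moebius B w) =
      quat_mult (quat_lin (p * B $ 1 $ 1 + q * B $ 2 $ 1) (p * B $ 1 $ 2 + q * B $ 2 $ 2) w) (quat_inverse y)"
    for p q
  proof -
    have "quat_lin p q (moebius B w) =
        quat_add (quat_mult (quat_of_complex p) (quat_mult x (quat_inverse y)))
                 (quat_mult (quat_of_complex q) (quat_mult y (quat_inverse y)))"
      using quat_mult_inverse(1)[OF y0]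
      by (simp add: quat_lin_def[of p] moebius_quat_eq(2)[OF B w] moebius_quat_lin flip: xy)
    also have "\<dots> = quat_mult (quat_add (quat_mult (quat_of_complex p) x) (quat_mult (quat_of_complex q) y))
        (quat_inverse y)"
      by (simp add: quat_add_def quat_mult_def quat_of_complex_def algebra_simps)
    also have "quat_add (quat_mult (quat_of_complex p) x) (quat_mult (quat_of_complex q) y) =
        quat_lin (p * B $ 1 $ 1 + q * B $ 2 $ 1) (p * B $ 1 $ 2 + q * B $ 2 $ 2) w"
      by (cases w) (simp add: xy quat_lin_Pair quat_add_def quat_mult_def quat_of_complex_def algebra_simps)
    finally show ?thesis .
  qed
  have "moebius_quat A (moebius B w) = moebius_quat (A ** B) w"
    using quat_lin_nonzero[OF AB w] y0
    by (simp add: moebius_quat_lin lin quat_fraction_cancel matrix_matrix_mult_def sum_2)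
  then show ?thesis by (simp add: moebius_def)
qed

lemma moebius_one [simp]: "moebius (mat 1) w = w"
  by (cases w) (simp add: moebius_def moebius_quat_lin quat_lin_Pair mat_def quat_inverse_def quat_mult_def)

text \<open>The squared quaternion norm of the denominator \<open>c w + e\<close>; by
  \<open>snd_moebius\<close> the action divides heights by it.\<close>

definition mden :: "complex^2^2 \<Rightarrow> point3 \<Rightarrow> real" where
  "mden A w = (cmod (A $ 2 $ 1 * fst w + A $ 2 $ 2))\<^sup>2 + (cmod (A $ 2 $ 1))\<^sup>2 * (snd w)\<^sup>2"

lemma mden_pos:
  assumes "det A = 1" "w \<in> H3"
  shows "0 < mden A w"
proof -
  have "mden A w \<noteq> 0"
    using quat_lin_nonzero[OF assms] assms(2)
    by (cases w) (auto simp: mden_def quat_lin_Pair H3_def add_nonneg_eq_0_iff)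
  moreover have "0 \<le> mden A w" by (simp add: mden_def)
  ultimately show ?thesis by simp
qed

lemma fst_moebius:
  "fst (moebius A (z, t)) =
     ((A $ 1 $ 1 * z + A $ 1 $ 2) * cnj (A $ 2 $ 1 * z + A $ 2 $ 2)
       + A $ 1 $ 1 * cnj (A $ 2 $ 1) * (of_real t)\<^sup>2) / of_real (mden A (z, t))"
proof -
  have m: "(cmod (A $ 2 $ 1 * z + A $ 2 $ 2))\<^sup>2 + (cmod (A $ 2 $ 1 * of_real t))\<^sup>2 = mden A (z, t)"
    by (simp add: mden_def norm_mult power_mult_distrib)
  have "fst (moebius A (z, t)) =
      (A $ 1 $ 1 * z + A $ 1 $ 2) * (cnj (A $ 2 $ 1 * z + A $ 2 $ 2) / of_real (mden A (z, t)))
       + A $ 1 $ 1 * of_real t * cnj (A $ 2 $ 1 * of_real t) / of_real (mden A (z, t))"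
    by (simp only: moebius_def moebius_quat_lin quat_lin_Pair quat_inverse_def Let_def fst_conv snd_conv m
        quat_mult_def) simp
  then show ?thesis by (simp add: power2_eq_square mult_ac flip: add_divide_distrib)
qed

lemma snd_moebius:
  assumes "det A = 1"
  shows "snd (moebius A (z, t)) = t / mden A (z, t)"
proof -
  have m: "(cmod (A $ 2 $ 1 * z + A $ 2 $ 2))\<^sup>2 + (cmod (A $ 2 $ 1 * of_real t))\<^sup>2 = mden A (z, t)"
    by (simp add: mden_def norm_mult power_mult_distrib)
  have "snd (moebius_quat A (z, t)) =
      (A $ 1 $ 1 * z + A $ 1 $ 2) * (- (A $ 2 $ 1 * of_real t) / of_real (mden A (z, t)))
       + A $ 1 $ 1 * of_real t * ((A $ 2 $ 1 * z + A $ 2 $ 2) / of_real (mden A (z, t)))"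
    by (simp only: moebius_quat_lin quat_lin_Pair quat_inverse_def Let_def fst_conv snd_conv m
        quat_mult_def) simp
  also have "\<dots> = det A * of_real t / of_real (mden A (z, t))"
    by (simp add: det_2 algebra_simps add_divide_distrib diff_divide_distrib)
  finally have "snd (moebius_quat A (z, t)) = of_real (t / mden A (z, t))"
    using assms by simp
  then show ?thesis by (simp only: moebius_def snd_conv Re_complex_of_real)
qed

definition mat2 :: "complex \<Rightarrow> complex \<Rightarrow> complex \<Rightarrow> complex \<Rightarrow> complex^2^2" where
  "mat2 a b c e = vector [vector [a, b], vector [c, e]]"

lemma mat2_nth [simp]:
  "mat2 a b c e $ 1 $ 1 = a" "mat2 a b c e $ 1 $ 2 = b"
  "mat2 a b c e $ 2 $ 1 = c" "mat2 a b c e $ 2 $ 2 = e"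
  by (simp_all add: mat2_def)

lemma moebius_translation: "moebius (mat2 1 l 0 1) (z, t) = (z + l, t)"
  by (rule prod_eqI) (simp_all add: fst_moebius snd_moebius mden_def det_2)

text \<open>The factor \<open>mden A w\<close>, positive on \<open>H3\<close> when
  \<open>det A = 1\<close>, clears denominators without changing the sign, so that a polynomial in
  the coordinates remains.\<close>

definition mirror_form :: "complex \<Rightarrow> complex^2^2 \<Rightarrow> point3 \<Rightarrow> real" where
  "mirror_form \<delta> A w = Im (cnj \<delta> * fst (moebius A w)) * mden A w"

text \<open>Expansion of \<open>fst_moebius\<close>. The term with \<open>cnj z\<close> is
  conjugated inside \<open>Im\<close>, which produces the minus sign in the coefficient of
  \<open>z\<close>.\<close>

lemma mirror_form_eq:
  assumes "det A = 1" "0 < t"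
  shows "mirror_form \<delta> A (z, t) =
    Im (cnj \<delta> * A $ 1 $ 1 * cnj (A $ 2 $ 1)) * ((cmod z)\<^sup>2 + t\<^sup>2)
    + Im ((cnj \<delta> * A $ 1 $ 1 * cnj (A $ 2 $ 2) - \<delta> * cnj (A $ 1 $ 2) * A $ 2 $ 1) * z)
    + Im (cnj \<delta> * A $ 1 $ 2 * cnj (A $ 2 $ 2))"
proof -
  obtain a b c e where abce: "a = A $ 1 $ 1" "b = A $ 1 $ 2" "c = A $ 2 $ 1" "e = A $ 2 $ 2" by blast
  have "mden A (z, t) \<noteq> 0" using mden_pos[of A "(z, t)"] assms by (simp add: H3_def)
  moreover have "Im (u / of_real m) * m = Im u" if "m \<noteq> 0" for u m
    using that by (simp add: Im_divide power2_eq_square)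
  ultimately have "mirror_form \<delta> A (z, t) =
      Im (cnj \<delta> * ((a * z + b) * cnj (c * z + e) + a * cnj c * (of_real t)\<^sup>2))"
    by (simp add: mirror_form_def fst_moebius abce times_divide_eq_right del: Im_divide_of_real)
  also have "\<dots> = Im (cnj \<delta> * a * cnj c) * ((cmod z)\<^sup>2 + t\<^sup>2)
      + Im ((cnj \<delta> * a * cnj e - \<delta> * cnj b * c) * z) + Im (cnj \<delta> * b * cnj e)"
    unfolding cmod_power2 by (simp add: power2_eq_square) algebra
  finally show ?thesis by (simp add: abce)
qed

text \<open>Invariance of the discriminant of a binary Hermitian form under substitution:
  \<open>Im (cnj \<delta> * z)\<close> has discriminant \<open>|\<delta>|^2\<close>, and the
  substitution multiplies it by \<open>|det|^2\<close>.\<close>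

lemma mirror_form_discriminant:
  "(cmod (cnj \<delta> * a * cnj e - \<delta> * cnj b * c))\<^sup>2
     - 4 * Im (cnj \<delta> * a * cnj c) * Im (cnj \<delta> * b * cnj e) = (cmod \<delta>)\<^sup>2 * (cmod (a * e - b * c))\<^sup>2"
  unfolding cmod_power2 by (simp add: power2_eq_square) algebra

subsection \<open>Cells of an invariant family of functions\<close>

text \<open>Abstract form of a closed chamber of the arrangement of zero sets: \<open>K\<close> lies
  on one side of each of them, and it is recovered from its signs as an intersection of
  half-spaces.\<close>

definition mirror_cell :: "(point3 \<Rightarrow> real) set \<Rightarrow> point3 set \<Rightarrow> bool" where
  "mirror_cell \<Phi> K \<longleftrightarrow> K \<subseteq> H3 \<and>
     (\<forall>\<phi>\<in>\<Phi>. (\<forall>v\<in>K. 0 \<le> \<phi> v) \<or> (\<forall>v\<in>K. \<phi> v \<le> 0)) \<and>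
     (\<forall>w\<in>H3. (\<forall>\<phi>\<in>\<Phi>. (\<forall>v\<in>K. 0 \<le> \<phi> v) \<longrightarrow> 0 \<le> \<phi> w) \<longrightarrow> w \<in> K)"

lemma mirror_cell_closedin:
  assumes K: "mirror_cell \<Phi> K"
    and closed: "\<And>\<phi>. \<phi> \<in> \<Phi> \<Longrightarrow> closedin (top_of_set H3) {w \<in> H3. 0 \<le> \<phi> w}"
  shows "closedin (top_of_set H3) K"
proof -
  \<comment> \<open>Inserting \<open>H3\<close> makes the family nonempty and keeps its intersection
    inside \<open>H3\<close>.\<close>
  define F where "F = insert H3 ((\<lambda>\<phi>. {w \<in> H3. 0 \<le> \<phi> w}) ` {\<phi> \<in> \<Phi>. \<forall>v\<in>K. 0 \<le> \<phi> v})"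
  have "K = \<Inter>F"
  proof
    show "K \<subseteq> \<Inter>F" using K by (auto simp: mirror_cell_def F_def)
    show "\<Inter>F \<subseteq> K"
    proof
      fix w assume w: "w \<in> \<Inter>F"
      then have "w \<in> H3" and "\<forall>\<phi>\<in>\<Phi>. (\<forall>v\<in>K. 0 \<le> \<phi> v) \<longrightarrow> 0 \<le> \<phi> w"
        by (auto simp: F_def)
      then show "w \<in> K" using K unfolding mirror_cell_def by blast
    qed
  qed
  moreover have "closedin (top_of_set H3) (\<Inter>F)"
    by (rule closedin_Inter) (auto simp: F_def closed)
  ultimately show ?thesis by simp
qed

text \<open>A function nonnegative on \<open>L\<close> cannot vanish at an interior point
  \<open>w\<close> of \<open>L\<close>, since by \<open>cross\<close> it would be negative nearby.
  It is therefore positive at \<open>w\<close>, hence nonnegative on all of \<open>K\<close>, and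
  \<open>L\<close> contains every point of \<open>H3\<close> satisfying these inequalities.\<close>

lemma mirror_cell_subset:
  assumes K: "mirror_cell \<Phi> K" and L: "mirror_cell \<Phi> L"
    and cross: "\<And>\<phi> w e. \<phi> \<in> \<Phi> \<Longrightarrow> w \<in> H3 \<Longrightarrow> \<phi> w = 0 \<Longrightarrow> 0 < e \<Longrightarrow> \<exists>v\<in>H3. dist v w < e \<and> \<phi> v < 0"
    and wK: "w \<in> top_of_set H3 interior_of K" and wL: "w \<in> top_of_set H3 interior_of L"
  shows "K \<subseteq> L"
proof
  fix v assume v: "v \<in> K"
  have wKL: "w \<in> K" "w \<in> L"
    by (rule subsetD[OF interior_of_subset wK], rule subsetD[OF interior_of_subset wL])
  obtain T where T: "openin (top_of_set H3) T" "T \<subseteq> L" "w \<in> T"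
    using wL by (auto simp: interior_of_def)
  then obtain U where U: "open U" "T = H3 \<inter> U" by (auto simp: openin_open)
  then obtain e where e: "0 < e" "ball w e \<subseteq> U" using T(3) open_contains_ball by blast
  have "0 \<le> \<phi> v" if \<phi>: "\<phi> \<in> \<Phi>" and nonneg: "\<forall>u\<in>L. 0 \<le> \<phi> u" for \<phi>
  proof -
    have "\<phi> w \<noteq> 0"
    proof
      assume "\<phi> w = 0"
      moreover have "w \<in> H3" using T U by blast
      ultimately obtain u where u: "u \<in> H3" "dist u w < e" "\<phi> u < 0"
        using cross[OF \<phi>] e(1) by blast
      then have "u \<in> ball w e" by (simp add: dist_commute)
      then have "u \<in> L" using e(2) U(2) T(2) u(1) by blast
      then show False using nonneg u(3) by force
    qed
    then have "0 < \<phi> w" using nonneg wKL(2) by force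
    then have "\<not> (\<forall>u\<in>K. \<phi> u \<le> 0)" using wKL(1) by force
    then show ?thesis using K \<phi> v unfolding mirror_cell_def by blast
  qed
  moreover have "v \<in> H3" using K v unfolding mirror_cell_def by blast
  ultimately show "v \<in> L" using L unfolding mirror_cell_def by blast
qed

text \<open>Pulling functions back along \<open>g\<close> transports the sign condition, and pulling
  them back along \<open>h\<close> transports completeness. The bijection of \<open>H3\<close> is
  arbitrary, so that group elements and complex conjugation are both covered.\<close>

lemma mirror_cell_image:
  assumes K: "mirror_cell \<Phi> K"
    and g: "\<And>w. w \<in> H3 \<Longrightarrow> g w \<in> H3" and h: "\<And>w. w \<in> H3 \<Longrightarrow> h w \<in> H3"
    and hg: "\<And>w. w \<in> H3 \<Longrightarrow> h (g w) = w" and gh: "\<And>w. w \<in> H3 \<Longrightarrow> g (h w) = w"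
    and \<Phi>g: "\<And>\<phi>. \<phi> \<in> \<Phi> \<Longrightarrow> \<exists>\<psi>\<in>\<Phi>. \<forall>w\<in>H3. \<psi> w = \<phi> (g w)"
    and \<Phi>h: "\<And>\<phi>. \<phi> \<in> \<Phi> \<Longrightarrow> \<exists>\<psi>\<in>\<Phi>. \<forall>w\<in>H3. \<psi> w = \<phi> (h w)"
  shows "mirror_cell \<Phi> (g ` K)"
proof -
  have KH: "K \<subseteq> H3" using K by (simp add: mirror_cell_def)
  have sign: "(\<forall>v\<in>g ` K. 0 \<le> \<phi> v) \<or> (\<forall>v\<in>g ` K. \<phi> v \<le> 0)" if \<phi>: "\<phi> \<in> \<Phi>" for \<phi>
  proof -
    obtain \<psi> where \<psi>: "\<psi> \<in> \<Phi>" "\<forall>w\<in>H3. \<psi> w = \<phi> (g w)" using \<Phi>g[OF \<phi>] by blast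
    have "(\<forall>v\<in>K. 0 \<le> \<psi> v) \<or> (\<forall>v\<in>K. \<psi> v \<le> 0)"
      using K \<psi>(1) unfolding mirror_cell_def by blast
    moreover have "\<phi> (g v) = \<psi> v" if "v \<in> K" for v using \<psi>(2) KH that by auto
    ultimately show ?thesis by auto
  qed
  have complete: "w \<in> g ` K" if w: "w \<in> H3" and nonneg: "\<forall>\<phi>\<in>\<Phi>. (\<forall>v\<in>g ` K. 0 \<le> \<phi> v) \<longrightarrow> 0 \<le> \<phi> w" for w
  proof -
    have "0 \<le> \<phi> (h w)" if \<phi>: "\<phi> \<in> \<Phi>" "\<forall>v\<in>K. 0 \<le> \<phi> v" for \<phi>
    proof -
      obtain \<psi> where \<psi>: "\<psi> \<in> \<Phi>" "\<forall>w\<in>H3. \<psi> w = \<phi> (h w)" using \<Phi>h[OF \<phi>(1)] by blast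
      have "\<forall>v\<in>g ` K. 0 \<le> \<psi> v" using \<psi>(2) \<phi>(2) KH g hg by auto
      then show ?thesis using nonneg \<psi> w by auto
    qed
    then have "h w \<in> K" using K h[OF w] unfolding mirror_cell_def by blast
    then show ?thesis using gh[OF w] by (metis imageI)
  qed
  show ?thesis using sign complete KH g unfolding mirror_cell_def by blast
qed

subsection \<open>The rings of integers\<close>

locale bianchi =
  fixes d :: nat
  assumes d: "d \<in> {1, 2, 3, 7, 11}"
begin

text \<open>The trace and the norm of \<open>omega d\<close>: it is a root of \<open>X^2 - tr X + nm\<close>.\<close>

definition tr :: int where "tr = (if d \<in> {1, 2} then 0 else 1)"
definition nm :: int where "nm = (if d \<in> {1, 2} then int d else (int d + 1) div 4)"
definition \<eta> :: real where "\<eta> = Im (omega d)"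

text \<open>The cases belong to \<open>d\<close> = 1, 2, 3, 7, 11 in this order.\<close>

lemma tr_nm_cases:
  obtains "tr = 0" "nm = 1" "d \<in> {1, 2}" | "tr = 0" "nm = 2" "d \<in> {1, 2}"
  | "tr = 1" "nm = 1" "d \<notin> {1, 2}" | "tr = 1" "nm = 2" "d \<notin> {1, 2}" | "tr = 1" "nm = 3" "d \<notin> {1, 2}"
  using d unfolding tr_def nm_def by auto

lemma eta_pos: "0 < \<eta>"
  using d by (auto simp: \<eta>_def omega_def)

lemma Re_omega: "Re (omega d) = tr / 2"
  using d by (auto simp: tr_def omega_def)

lemma eta_square: "4 * \<eta>\<^sup>2 = 4 * nm - tr\<^sup>2"
  using d by (auto simp: \<eta>_def omega_def tr_def nm_def power_divide)

lemma cnj_omega: "cnj (omega d) = of_int tr - omega d"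
  by (simp add: complex_eq_iff Re_omega)

definition pt :: "real \<Rightarrow> real \<Rightarrow> complex" where
  "pt x y = of_real x + of_real y * omega d"

lemma Re_pt: "Re (pt x y) = x + y * tr / 2" and Im_pt: "Im (pt x y) = y * \<eta>"
  by (simp_all add: pt_def Re_omega \<eta>_def)

lemma pt_diff: "pt x y - pt x' y' = pt (x - x') (y - y')"
  by (simp add: pt_def algebra_simps)

lemma pt_add: "pt x y + pt x' y' = pt (x + x') (y + y')"
  by (simp add: pt_def algebra_simps)

lemma pt_surj: obtains x y where "z = pt x y"
proof -
  have "z = pt (Re z - Im z / \<eta> * tr / 2) (Im z / \<eta>)"
    using eta_pos by (simp add: complex_eq_iff Re_pt Im_pt)
  then show ?thesis using that by blast
qed

lemma pt_eq_iff: "pt x y = pt x' y' \<longleftrightarrow> x = x' \<and> y = y'"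
  using eta_pos by (auto simp: complex_eq_iff Re_pt Im_pt)

lemma cmod_pt:
  fixes x y :: real
  shows "(cmod (pt x y))\<^sup>2 = x\<^sup>2 + tr * x * y + nm * y\<^sup>2"
proof -
  have "(cmod (pt x y))\<^sup>2 = (x + y * tr / 2)\<^sup>2 + y\<^sup>2 * (4 * \<eta>\<^sup>2) / 4"
    by (simp add: cmod_power2 Re_pt Im_pt power_mult_distrib)
  then show ?thesis unfolding eta_square by (simp add: power2_eq_square field_simps)
qed

lemma pt_mult:
  fixes x y x' y' :: real
  shows "pt x y * pt x' y' = pt (x * x' - nm * y * y') (x * y' + x' * y + tr * y * y')"
proof -
  have e: "\<eta> * \<eta> = nm - tr * tr / 4" using eta_square by (simp add: power2_eq_square)
  have "y * \<eta> * (y' * \<eta>) = y * y' * (\<eta> * \<eta>)" by simp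
  then have "y * \<eta> * (y' * \<eta>) = y * y' * (nm - tr * tr / 4)" unfolding e .
  then show ?thesis
    by (intro complex_eqI; simp only: times_complex.simps Re_pt Im_pt) (simp_all add: field_simps)
qed

lemma cnj_pt:
  fixes x y :: real
  shows "cnj (pt x y) = pt (x + tr * y) (- y)"
  by (simp add: complex_eq_iff Re_pt Im_pt algebra_simps)

lemma Z_omega_iff: "z \<in> Z_omega d \<longleftrightarrow> (\<exists>m n. z = pt (of_int m) (of_int n))"
  by (simp add: Z_omega_def pt_def)

lemma pt_Z_omega [simp]: "pt (of_int m) (of_int n) \<in> Z_omega d"
  using Z_omega_iff by blast

lemma Z_omega_of_int: "of_int m \<in> Z_omega d"
  using pt_Z_omega[of m 0] by (simp add: pt_def)

lemma Z_omega_0_1 [simp]: "0 \<in> Z_omega d" "1 \<in> Z_omega d"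
  using Z_omega_of_int[of 0] Z_omega_of_int[of 1] by simp_all

lemma omega_Z_omega [simp]: "omega d \<in> Z_omega d"
  using pt_Z_omega[of 0 1] by (simp add: pt_def)

lemma Z_omega_add: "x \<in> Z_omega d \<Longrightarrow> y \<in> Z_omega d \<Longrightarrow> x + y \<in> Z_omega d"
  unfolding Z_omega_iff using pt_add of_int_add by metis

lemma Z_omega_diff: "x \<in> Z_omega d \<Longrightarrow> y \<in> Z_omega d \<Longrightarrow> x - y \<in> Z_omega d"
  unfolding Z_omega_iff using pt_diff of_int_diff by metis

lemma Z_omega_minus: "x \<in> Z_omega d \<Longrightarrow> - x \<in> Z_omega d"
  using Z_omega_diff[of 0 x] by simp

lemma Z_omega_mult: "x \<in> Z_omega d \<Longrightarrow> y \<in> Z_omega d \<Longrightarrow> x * y \<in> Z_omega d"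
proof -
  assume "x \<in> Z_omega d" "y \<in> Z_omega d"
  then obtain m n m' n' where "x = pt (of_int m) (of_int n)" "y = pt (of_int m') (of_int n')" by (auto simp: Z_omega_iff)
  then have "x * y = pt (of_int (m * m' - nm * n * n')) (of_int (m * n' + m' * n + tr * n * n'))"
    by (simp add: pt_mult)
  then show ?thesis by (simp only: pt_Z_omega)
qed

lemma Z_omega_cnj: "x \<in> Z_omega d \<Longrightarrow> cnj x \<in> Z_omega d"
proof -
  assume "x \<in> Z_omega d"
  then obtain m n where "x = pt (of_int m) (of_int n)" by (auto simp: Z_omega_iff)
  then have "cnj x = pt (of_int (m + tr * n)) (of_int (- n))" by (simp add: cnj_pt)
  then show ?thesis by (simp only: pt_Z_omega)
qed

lemma Im_Z_omega: "x \<in> Z_omega d \<Longrightarrow> \<exists>j :: int. Im x = \<eta> * j"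
  by (auto simp: Z_omega_iff Im_pt)

lemma SL2_iff:
  "A \<in> SL2 d \<longleftrightarrow> A $ 1 $ 1 \<in> Z_omega d \<and> A $ 1 $ 2 \<in> Z_omega d \<and> A $ 2 $ 1 \<in> Z_omega d
     \<and> A $ 2 $ 2 \<in> Z_omega d \<and> A $ 1 $ 1 * A $ 2 $ 2 - A $ 1 $ 2 * A $ 2 $ 1 = 1"
  by (auto simp: SL2_def det_2 forall_2)

lemma SL2_det: "A \<in> SL2 d \<Longrightarrow> det A = 1"
  by (simp add: SL2_def)

lemma SL2_mult: "A \<in> SL2 d \<Longrightarrow> B \<in> SL2 d \<Longrightarrow> A ** B \<in> SL2 d"
  unfolding SL2_def
  by (auto simp: det_mul) (auto simp: matrix_matrix_mult_def sum_2 intro!: Z_omega_add Z_omega_mult)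

lemma SL2_inverse:
  assumes "A \<in> SL2 d"
  obtains B where "B \<in> SL2 d" "A ** B = mat 1" "B ** A = mat 1"
proof
  let ?B = "mat2 (A $ 2 $ 2) (- (A $ 1 $ 2)) (- (A $ 2 $ 1)) (A $ 1 $ 1)"
  show "?B \<in> SL2 d" using assms by (auto simp: SL2_iff algebra_simps intro: Z_omega_minus)
  show "A ** ?B = mat 1" "?B ** A = mat 1"
    using assms
    by (auto simp: SL2_iff vec_eq_iff forall_2 matrix_matrix_mult_def sum_2 mat_def algebra_simps)
qed

lemma translation_SL2: "l \<in> Z_omega d \<Longrightarrow> mat2 1 l 0 1 \<in> SL2 d"
  by (simp add: SL2_iff)

lemma moebius_H3: "A \<in> SL2 d \<Longrightarrow> w \<in> H3 \<Longrightarrow> moebius A w \<in> H3"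
  by (simp add: SL2_det moebius_quat_eq(1))

lemma moebius_inverse:
  assumes "A \<in> SL2 d" "B \<in> SL2 d" "A ** B = mat 1" "w \<in> H3"
  shows "moebius A (moebius B w) = w"
  using moebius_mult[of A B w] assms by (simp add: SL2_det)

subsection \<open>Binary forms and the Ford domain\<close>

text \<open>Coordinates \<open>x, y\<close> always refer to the point \<open>x + y * omega d\<close>.\<close>

definition in_base :: "real \<Rightarrow> real \<Rightarrow> bool" where
  "in_base x y \<longleftrightarrow> 0 \<le> x \<and> 0 \<le> y \<and> (if tr = 0 then x \<le> 1 \<and> y \<le> 1 else x + y \<le> 1)"

text \<open>The norm form: the squared modulus of \<open>pt x y\<close>, by
  \<open>cmod_pt\<close>.\<close>

definition qf :: "real \<Rightarrow> real \<Rightarrow> real" where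
  "qf x y = x\<^sup>2 + real_of_int tr * x * y + real_of_int nm * y\<^sup>2"

text \<open>Equal to \<open>4 * \<eta>\<^sup>2\<close>; this is the absolute value of the
  discriminant of the quadratic field (4, 8, 3, 7, 11).\<close>

definition disc :: int where "disc = 4 * nm - tr\<^sup>2"

text \<open>Four times the norm form is \<open>(2 m + tr n)^2 + disc n^2\<close>, which bounds
  \<open>n\<close> and then \<open>m\<close>. The conclusion says that every lattice vector whose
  norm is that of an edge direction is, up to sign, 1, \<open>omega d\<close> or, for triangles,
  \<open>1 - omega d\<close>.\<close>

lemma norm_form_small:
  fixes m n :: int
  assumes eq: "m\<^sup>2 + tr * m * n + nm * n\<^sup>2 = N" and N: "N = 1 \<or> N = nm"
  shows "(m, n) \<in> {(1, 0), (-1, 0), (0, 1), (0, -1)} \<union> (if tr = 0 then {} else {(1, -1), (-1, 1)})"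
proof -
  have nm: "1 \<le> nm" "nm \<le> 3" "tr = 0 \<or> tr = 1" "tr = 0 \<Longrightarrow> nm \<le> 2" by (cases rule: tr_nm_cases; simp)+
  have sq: "(2 * m + tr * n)\<^sup>2 + (4 * nm - tr\<^sup>2) * n\<^sup>2 = 4 * N"
    by (simp add: power2_eq_square algebra_simps flip: eq)
  have "3 * n\<^sup>2 \<le> (4 * nm - tr\<^sup>2) * n\<^sup>2"
    using nm by (intro mult_right_mono) auto
  moreover have "(4 * nm - 1) * n\<^sup>2 \<le> (4 * nm - tr\<^sup>2) * n\<^sup>2"
    using nm by (intro mult_right_mono) auto
  moreover have "0 \<le> (2 * m + tr * n)\<^sup>2" by simp
  ultimately have "(4 * nm - 1) * n\<^sup>2 \<le> 4 * nm" using sq N nm by linarith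
  then have "n\<^sup>2 < 4"
  proof -
    have "(4 * nm - 1) * 4 \<le> (4 * nm - 1) * n\<^sup>2" if "4 \<le> n\<^sup>2"
      using that nm by (intro mult_left_mono) auto
    then show ?thesis using \<open>(4 * nm - 1) * n\<^sup>2 \<le> 4 * nm\<close> nm by (cases "4 \<le> n\<^sup>2") auto
  qed
  then have "\<bar>n\<bar> < 2" using power2_less_imp_less[of "\<bar>n\<bar>" 2] by simp
  then have n: "n = -1 \<or> n = 0 \<or> n = 1" by arith
  have "(2 * m + tr * n)\<^sup>2 \<le> 4 * N" using sq \<open>3 * n\<^sup>2 \<le> (4 * nm - tr\<^sup>2) * n\<^sup>2\<close> zero_le_power2[of n] by linarith
  then have "(2 * m + tr * n)\<^sup>2 < 4\<^sup>2" using N nm by auto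
  then have "\<bar>2 * m + tr * n\<bar> < 4" using power2_less_imp_less[of "\<bar>2 * m + tr * n\<bar>" 4] by simp
  then have "m = -2 \<or> m = -1 \<or> m = 0 \<or> m = 1 \<or> m = 2" using n nm(3) by auto
  with n eq N show ?thesis by (cases rule: tr_nm_cases) (elim disjE; simp)+
qed

text \<open>On the base polygon each of the possible linear forms takes values in
  \<open>[0, 1]\<close> or in \<open>[-1, 0]\<close>. Adding an integer cannot make such a form
  change sign.\<close>

lemma vertical_sign:
  fixes m n l :: int
  assumes eq: "m\<^sup>2 + tr * m * n + nm * n\<^sup>2 = N" and N: "N = 1 \<or> N = nm"
  shows "(\<forall>(x::real) (y::real). in_base x y \<longrightarrow> 0 \<le> m * y + n * x + tr * n * y + l) \<or>
    (\<forall>(x::real) (y::real). in_base x y \<longrightarrow> m * y + n * x + tr * n * y + l \<le> 0)"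
proof -
  have tr: "tr = 0 \<or> tr = 1" by (simp add: tr_def)
  let ?v = "\<lambda>(x::real) (y::real). m * y + n * x + tr * n * y"
  have "(m = 1 \<and> n = 0) \<or> (m = -1 \<and> n = 0) \<or> (m = 0 \<and> n = 1) \<or> (m = 0 \<and> n = -1)
      \<or> (tr = 1 \<and> m = 1 \<and> n = -1) \<or> (tr = 1 \<and> m = -1 \<and> n = 1)"
    using norm_form_small[OF eq N] tr by (auto split: if_splits)
  then consider "\<And>x y. in_base x y \<Longrightarrow> 0 \<le> ?v x y \<and> ?v x y \<le> 1"
    | "\<And>x y. in_base x y \<Longrightarrow> -1 \<le> ?v x y \<and> ?v x y \<le> 0"
    using tr by (elim disjE conjE) (force simp: in_base_def)+
  moreover have "1 \<le> real_of_int l \<or> real_of_int l = 0 \<or> real_of_int l \<le> -1" by (cases l "0 :: int" rule: linorder_cases) auto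
  ultimately show ?thesis by cases (elim disjE; force)+
qed

text \<open>Lower bound for the height of a point over the base polygon outside all unit balls
  around lattice points. In the rectangle some corner is within 1/2 in both coordinates; in the
  triangle the squared circumradius \<open>nm\<^sup>2 / disc\<close> takes over.\<close>

lemma height_bound:
  fixes x y t :: real
  assumes W: "in_base x y" and ford: "\<And>(a::int) (b::int). 1 \<le> qf (x - a) (y - b) + t\<^sup>2"
  shows "t\<^sup>2 \<ge> (if tr = 0 then 1 / 4 else 1 - nm\<^sup>2 / disc)"
proof (cases "tr = 0")
  case True
  then have nm: "nm = 1 \<or> nm = 2" by (cases rule: tr_nm_cases; simp)
  have half: "\<exists>a :: int. (u - a)\<^sup>2 \<le> 1 / 4" if "0 \<le> u" "u \<le> 1" for u :: real
  proof -
    have "\<bar>u\<bar> \<le> \<bar>1 / 2\<bar> \<or> \<bar>u - 1\<bar> \<le> \<bar>1 / 2\<bar>" using that by linarith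
    then have "u\<^sup>2 \<le> (1 / 2)\<^sup>2 \<or> (u - 1)\<^sup>2 \<le> (1 / 2)\<^sup>2"
      unfolding abs_le_square_iff .
    then have "(u - of_int 0)\<^sup>2 \<le> 1 / 4 \<or> (u - of_int 1)\<^sup>2 \<le> 1 / 4"
      by (simp add: power_divide)
    then show ?thesis by blast
  qed
  obtain a b :: int where "(x - a)\<^sup>2 \<le> 1 / 4" "(y - b)\<^sup>2 \<le> 1 / 4"
    using half[of x] half[of y] W True by (auto simp: in_base_def)
  then show ?thesis using ford[of a b] nm True by (auto simp: qf_def)
next
  case False
  then have tr: "tr = 1" by (simp add: tr_def split: if_splits)
  have D: "real_of_int disc = 4 * nm - 1" "0 < real_of_int disc"
    using tr unfolding disc_def by (cases rule: tr_nm_cases; simp)+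
  \<comment> \<open>The inequalities for the three corners are averaged with the barycentric
    coordinates of the point as weights.\<close>
  have "0 \<le> (1 - x - y) * (qf x y + t\<^sup>2 - 1) + x * (qf (x - 1) y + t\<^sup>2 - 1) + y * (qf x (y - 1) + t\<^sup>2 - 1)"
    using W ford[of 0 0] ford[of 1 0] ford[of 0 1] False
    by (intro add_nonneg_nonneg mult_nonneg_nonneg) (auto simp: in_base_def)
  also have "\<dots> = t\<^sup>2 - 1 + (x + nm * y - qf x y)"
    by (simp add: qf_def tr power2_eq_square algebra_simps)
  \<comment> \<open>The left side is the squared circumradius minus the squared distance to the
    circumcentre, which has real part 1/2 and second lattice coordinate
    \<open>(2 * nm - 1) / disc\<close>.\<close>
  also have "x + nm * y - qf x y =
      nm\<^sup>2 / disc - ((x + y / 2 - 1 / 2)\<^sup>2 + disc / 4 * (y - (2 * nm - 1) / disc)\<^sup>2)"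
  proof -
    define C where "C = (2 * nm - 1) / disc"
    have C: "disc * C = 2 * nm - 1" using D(2) by (simp add: C_def)
    have "disc / 4 * (y - C)\<^sup>2 = disc * y\<^sup>2 / 4 - y * (disc * C) / 2 + disc * C * C / 4"
      by (simp add: power2_eq_square field_simps)
    then have 1: "disc / 4 * (y - C)\<^sup>2 = disc * y\<^sup>2 / 4 - y * (2 * nm - 1) / 2 + (2 * nm - 1) * C / 4"
      unfolding C .
    have "nm\<^sup>2 = disc * ((2 * nm - 1) * C / 4 + 1 / 4)"
    proof -
      have "disc * ((2 * nm - 1) * C / 4 + 1 / 4) = (2 * nm - 1) * (disc * C) / 4 + disc / 4"
        by (simp add: algebra_simps)
      also have "\<dots> = nm\<^sup>2" unfolding C unfolding D(1) by (simp add: power2_eq_square field_simps)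
      finally show ?thesis by simp
    qed
    then have 2: "nm\<^sup>2 / disc = (2 * nm - 1) * C / 4 + 1 / 4" using D(2) by simp
    show ?thesis
      unfolding C_def[symmetric] unfolding 1 2 unfolding D(1)
      by (simp add: qf_def tr power2_eq_square field_simps)
  qed
  finally have "0 \<le> t\<^sup>2 - 1 + nm\<^sup>2 / disc - ((x + y / 2 - 1 / 2)\<^sup>2 + disc / 4 * (y - (2 * nm - 1) / disc)\<^sup>2)"
    by simp
  moreover have "0 \<le> (x + y / 2 - 1 / 2)\<^sup>2 + disc / 4 * (y - (2 * nm - 1) / disc)\<^sup>2"
    using D(2) by simp
  ultimately show ?thesis using False by simp
qed

text \<open>The last bracket is \<open>j^2\<close> times the squared distance in the plane to the
  centre of the hemisphere, whose squared radius is \<open>N / (disc j^2)\<close>. Hence the product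
  is nonnegative at every point at least as high as the radius.\<close>

lemma form_complete_square:
  fixes j m n l N :: int and x y t :: real
  assumes disc: "m\<^sup>2 + tr * m * n + nm * n\<^sup>2 - disc * j * l = N"
  shows "j * (j * (qf x y + t\<^sup>2) + (m * y + n * x + tr * n * y) + l) =
    j\<^sup>2 * t\<^sup>2 - N / disc + ((j * (x + tr * y / 2) + n / 2)\<^sup>2 + disc / 4 * (j * y + (2 * m + tr * n) / disc)\<^sup>2)"
proof -
  have D: "real_of_int disc = 4 * nm - tr\<^sup>2" "real_of_int disc \<noteq> 0"
    unfolding disc_def by (cases rule: tr_nm_cases; simp)+
  define C where "C = (2 * m + tr * n) / disc"
  have C: "disc * C = 2 * m + tr * n" using D(2) by (simp add: C_def)
  have "disc / 4 * (j * y + C)\<^sup>2 = disc * j\<^sup>2 * y\<^sup>2 / 4 + j * y * (disc * C) / 2 + disc * C * C / 4"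
    by (simp add: power2_eq_square field_simps)
  then have 1: "disc / 4 * (j * y + C)\<^sup>2 =
      disc * j\<^sup>2 * y\<^sup>2 / 4 + j * y * (2 * m + tr * n) / 2 + (2 * m + tr * n) * C / 4"
    unfolding C .
  have "4 * N = (2 * m + tr * n) * (2 * m + tr * n) + disc * n\<^sup>2 - 4 * (disc * j * l)"
    by (simp add: power2_eq_square algebra_simps disc_def flip: assms)
  then have "4 * real_of_int N = (2 * m + tr * n) * (2 * m + tr * n) + disc * n\<^sup>2 - 4 * (disc * j * l)"
    by linarith
  moreover have "disc * ((2 * m + tr * n) * C + n\<^sup>2 - 4 * (j * l)) =
      (2 * m + tr * n) * (disc * C) + disc * n\<^sup>2 - 4 * (disc * j * l)"
    by (simp add: algebra_simps)
  ultimately have "4 * N = disc * ((2 * m + tr * n) * C + n\<^sup>2 - 4 * (j * l))"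
    unfolding C by simp
  then have "N = disc * (((2 * m + tr * n) * C + n\<^sup>2 - 4 * (j * l)) / 4)" by simp
  then have "N / disc = ((2 * m + tr * n) * C + n\<^sup>2 - 4 * (j * l)) / 4"
    using D(2) by simp
  then have 2: "N / disc = (2 * m + tr * n) * C / 4 + n\<^sup>2 / 4 - j * l"
    by (simp add: add_divide_distrib diff_divide_distrib)
  show ?thesis
    unfolding C_def[symmetric] unfolding 1 2
    by (simp add: qf_def D(1) power2_eq_square field_simps)
qed

text \<open>For \<open>d = 11\<close> the hemispheres of radius \<open>sqrt (3 / 11)\<close> are higher than the
  lowest points of the Ford domain, but each of them lies inside the union of the unit balls around
  two neighbouring lattice points \<open>a + b * omega\<close> and \<open>a + 1 + b * omega\<close>.\<close>

lemma form_nonneg_large_hemisphere: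
  fixes m n l :: int and x y t :: real
  assumes tr: "tr = 1" and nm: "nm = 3"
    and disc: "m\<^sup>2 + m * n + 3 * n\<^sup>2 - 11 * l = 3"
    and ford: "\<And>(a::int) (b::int). 1 \<le> qf (x - a) (y - b) + t\<^sup>2"
  shows "0 \<le> qf x y + t\<^sup>2 + (m * y + n * x + n * y) + l"
proof -
  \<comment> \<open>The centre of the hemisphere has second lattice coordinate
    \<open>- u / 11\<close>. As \<open>u^2\<close> is 1 modulo 11, it differs by 1/11 from an
    integer \<open>b\<close>, with \<open>s\<close> recording the side.\<close>
  define u where "u = 2 * m + n"
  have u: "u\<^sup>2 = 12 + 44 * l - 11 * n\<^sup>2"
    using disc by (simp add: u_def power2_eq_square algebra_simps)
  have "11 dvd (u - 1) * (u + 1)"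
  proof
    show "(u - 1) * (u + 1) = 11 * (1 + 4 * l - n\<^sup>2)" using u by (simp add: power2_eq_square algebra_simps)
  qed
  moreover have "prime (11 :: int)" by simp
  ultimately have "11 dvd u - 1 \<or> 11 dvd u + 1" using prime_dvd_mult_iff by blast
  then obtain b s :: int where b: "u = - 11 * b - s" and s: "s = 1 \<or> s = -1"
  proof
    assume "11 dvd u - 1"
    then obtain c where "u - 1 = 11 * c" by (elim dvdE)
    then show ?thesis using that[of "- c" "-1"] by simp
  next
    assume "11 dvd u + 1"
    then obtain c where "u + 1 = 11 * c" by (elim dvdE)
    then show ?thesis using that[of "- c" 1] by simp
  qed
  \<comment> \<open>Modulo 2, \<open>n\<close> agrees with \<open>u\<close>, hence with
    \<open>b + 1\<close>. So the centre, of real part \<open>- n / 2\<close>, projects to the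
    midpoint of two neighbouring lattice points of row \<open>b\<close>.\<close>
  have "even (n + b + 1)" using b s unfolding u_def by presburger
  then obtain a where a: "n + b + 1 = - 2 * a" by (metis dvdE minus_mult_minus)
  have n: "n = - 2 * a - b - 1" and m: "2 * m = 2 * a - 10 * b + 1 - s"
    using a b by (auto simp: u_def)
  \<comment> \<open>Coordinates relative to that midpoint: \<open>X\<close> is the real part, and
    the imaginary part is \<open>\<eta>\<close> times \<open>Y\<close>.\<close>
  define X Y where XY: "X = x - a - 1 / 2 + (y - b) / 2" "Y = y - b"
  have "1 \<le> (X + 1 / 2)\<^sup>2 + 11 / 4 * Y\<^sup>2 + t\<^sup>2"
    using ford[of a b] unfolding qf_def tr nm XY by (simp add: power2_eq_square field_simps)
  moreover have "1 \<le> (X - 1 / 2)\<^sup>2 + 11 / 4 * Y\<^sup>2 + t\<^sup>2"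
    using ford[of "a + 1" b] unfolding qf_def tr nm XY by (simp add: power2_eq_square field_simps)
  moreover have "(X + 1 / 2)\<^sup>2 + (X - 1 / 2)\<^sup>2 = 2 * X\<^sup>2 + 1 / 2"
    by (simp add: power2_eq_square field_simps)
  ultimately have ball: "3 / 4 \<le> X\<^sup>2 + 11 / 4 * Y\<^sup>2 + t\<^sup>2" by linarith
  \<comment> \<open>Completing the square bounds the linear term by half of the quantity in
    \<open>ball\<close> plus 1/22; what remains is at least 3/8 - 1/22, which exceeds 1/4.\<close>
  have "0 \<le> 11 / 8 * (Y - 2 / 11 * s)\<^sup>2" by simp
  also have "\<dots> = 11 / 8 * Y\<^sup>2 - s * Y / 2 + 1 / 22"
    using s by (auto simp: power2_eq_square field_simps)
  finally have "s * Y / 2 \<le> 11 / 8 * Y\<^sup>2 + 1 / 22" by simp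
  then have *: "1 / 4 \<le> X\<^sup>2 + 11 / 4 * Y\<^sup>2 + t\<^sup>2 - s * Y / 2"
    using ball zero_le_power2[of X] zero_le_power2[of t] by linarith
  have l: "44 * real_of_int l = u\<^sup>2 - 12 + 11 * n\<^sup>2" using u by linarith
  have m': "real_of_int m = (2 * a - 10 * b + 1 - s) / 2" unfolding m[symmetric] by simp
  have s2: "real_of_int s * s = 1" using s by auto
  have "44 * (qf x y + t\<^sup>2 + (m * y + n * x + n * y) + l) =
      44 * (X\<^sup>2 + 11 / 4 * Y\<^sup>2 + t\<^sup>2 - s * Y / 2 - 1 / 4) + (real_of_int s * s - 1)"
    unfolding distrib_left l m' n b qf_def tr nm XY by (simp add: power2_eq_square field_simps)
  then show ?thesis using * s2 by simp
qed

text \<open>By \<open>height_bound\<close> the point is at least as high as the radius of the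
  hemisphere, so \<open>form_complete_square\<close> applies. The comparison fails only for
  \<open>nm = 3\<close>, \<open>N = 3\<close>, \<open>|j| = 1\<close>, where \<open>3 / 11\<close>
  exceeds the bound \<open>2 / 11\<close>; there \<open>form_nonneg_large_hemisphere\<close> is
  used. The factor \<open>j\<close> makes the claim independent of the sign of the form.\<close>

lemma form_nonneg_ford:
  fixes j m n l N :: int and x y t :: real
  assumes W: "in_base x y" and ford: "\<And>(a::int) (b::int). 1 \<le> qf (x - a) (y - b) + t\<^sup>2"
    and disc: "m\<^sup>2 + tr * m * n + nm * n\<^sup>2 - disc * j * l = N" and N: "N = 1 \<or> N = nm" and j: "j \<noteq> 0"
  shows "0 \<le> j * (j * (qf x y + t\<^sup>2) + (m * y + n * x + tr * n * y) + l)"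
proof (cases "tr = 1 \<and> nm = 3 \<and> N = 3 \<and> \<bar>j\<bar> = 1")
  case True
  then have tn: "tr = 1" "nm = 3" and D: "disc = 11" and j: "j = 1 \<or> j = -1"
    by (auto simp: disc_def)
  from j show ?thesis
  proof
    assume "j = 1"
    then show ?thesis
      using form_nonneg_large_hemisphere[OF tn _ ford, of m n l] disc True D by (simp add: tn)
  next
    assume "j = -1"
    then show ?thesis
      using form_nonneg_large_hemisphere[OF tn _ ford, of "- m" "- n" "- l"] disc True D by (simp add: tn)
  qed
next
  case False
  have D: "0 < disc" unfolding disc_def by (cases rule: tr_nm_cases; simp)
  have j1: "1 \<le> j\<^sup>2" using j by (simp add: int_one_le_iff_zero_less)
  have "N / disc \<le> j\<^sup>2 * t\<^sup>2"
  proof (cases "\<bar>j\<bar> = 1")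
    case True
    then have "N / disc \<le> t\<^sup>2"
      using height_bound[OF W ford] False N
      by (cases rule: tr_nm_cases) (auto simp: disc_def)
    moreover have "j\<^sup>2 = 1" using True by (metis one_power2 power2_abs)
    ultimately show ?thesis by simp
  next
    case False
    then have "2 \<le> \<bar>j\<bar>" using j by linarith
    then have "2\<^sup>2 \<le> \<bar>j\<bar>\<^sup>2" by (intro power_mono) auto
    then have "4 \<le> j\<^sup>2" by simp
    then have "4 * t\<^sup>2 \<le> j\<^sup>2 * t\<^sup>2" by (intro mult_right_mono) (simp_all flip: of_int_power)
    moreover have "N / disc \<le> 4 * t\<^sup>2"
      using height_bound[OF W ford] N
      by (cases rule: tr_nm_cases) (auto simp: disc_def)
    ultimately show ?thesis by linarith
  qed
  then show ?thesis
    unfolding form_complete_square[OF disc] using D by simp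
qed

end

subsection \<open>Hemispheres and lines\<close>

text \<open>A form vanishing on a hemisphere is a multiple of its equation: the top of the
  hemisphere and two further points on it give linear equations for \<open>B\<close> and
  \<open>q\<close>.\<close>

lemma hemisphere_form_eq:
  assumes r: "0 < r"
    and zero: "\<And>z t. (z, t) \<in> hemisphere c r \<Longrightarrow> p * ((cmod z)\<^sup>2 + t\<^sup>2) + Im (B * z) + q = 0"
  shows "p * ((cmod z)\<^sup>2 + t\<^sup>2) + Im (B * z) + q = p * ((cmod (z - c))\<^sup>2 + t\<^sup>2 - r\<^sup>2)"
proof -
  have hemi: "(c + u, s) \<in> hemisphere c r" if "(Re u)\<^sup>2 + (Im u)\<^sup>2 + s\<^sup>2 = r\<^sup>2" "0 < s" for u s
    using that r by (simp add: hemisphere_def H3_def dist_norm norm_Pair cmod_power2)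
  have eqs: "p * ((Re c + Re u)\<^sup>2 + (Im c + Im u)\<^sup>2 + s\<^sup>2) + Re B * (Im c + Im u) + Im B * (Re c + Re u) + q = 0"
    if "(Re u)\<^sup>2 + (Im u)\<^sup>2 + s\<^sup>2 = r\<^sup>2" "0 < s" for u s
    using zero[OF hemi[OF that]] by (simp add: cmod_power2)
  have 0: "p * ((Re c)\<^sup>2 + (Im c)\<^sup>2 + r\<^sup>2) + Re B * Im c + Im B * Re c + q = 0"
    using eqs[of 0 r] r by simp
  \<comment> \<open>The offsets 3/5 and 4/5 give a point of the hemisphere with rational multiples
    of \<open>r\<close>.\<close>
  have "p * ((Re c + 3 / 5 * r)\<^sup>2 + (Im c)\<^sup>2 + (4 / 5 * r)\<^sup>2) + Re B * Im c + Im B * (Re c + 3 / 5 * r) + q = 0"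
    using eqs[of "of_real (3 / 5 * r)" "4 / 5 * r"] r by (simp add: power2_eq_square)
  then have "r * (Im B + 2 * p * Re c) = 0"
    using 0 by (simp add: power2_eq_square algebra_simps)
  then have B1: "Im B = - 2 * p * Re c" using r by simp
  have "p * ((Re c)\<^sup>2 + (Im c + 3 / 5 * r)\<^sup>2 + (4 / 5 * r)\<^sup>2) + Re B * (Im c + 3 / 5 * r) + Im B * Re c + q = 0"
    using eqs[of "Complex 0 (3 / 5 * r)" "4 / 5 * r"] r by (simp add: power2_eq_square)
  then have "r * (Re B + 2 * p * Im c) = 0"
    using 0 by (simp add: power2_eq_square algebra_simps)
  then have B2: "Re B = - 2 * p * Im c" using r by simp
  have q: "q = - (p * ((Re c)\<^sup>2 + (Im c)\<^sup>2 + r\<^sup>2)) - Re B * Im c - Im B * Re c" using 0 by linarith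
  show ?thesis unfolding q cmod_power2 by (simp add: B1 B2 power2_eq_square algebra_simps)
qed

lemma form_center:
  fixes p q :: real
  assumes p: "p \<noteq> 0"
  shows "\<exists>c. \<forall>z t. p * ((cmod z)\<^sup>2 + t\<^sup>2) + Im (B * z) + q =
    p * ((cmod (z - c))\<^sup>2 + t\<^sup>2 - ((cmod B)\<^sup>2 - 4 * p * q) / (4 * p\<^sup>2))"
proof -
  define u v where uv: "u = - Im B / (2 * p)" "v = - Re B / (2 * p)"
  have B: "Im B = - 2 * p * u" "Re B = - 2 * p * v" using p by (simp_all add: uv)
  have R: "((cmod B)\<^sup>2 - 4 * p * q) / (4 * p\<^sup>2) = u\<^sup>2 + v\<^sup>2 - q / p"
    unfolding cmod_power2 B using p by (simp add: power2_eq_square field_simps)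
  have "p * ((Re z - u)\<^sup>2 + (Im z - v)\<^sup>2 + t\<^sup>2 - (u\<^sup>2 + v\<^sup>2 - q / p)) =
      p * ((Re z)\<^sup>2 + (Im z)\<^sup>2 + t\<^sup>2) - 2 * p * u * Re z - 2 * p * v * Im z + p * (q / p)" for z t
    by (simp add: power2_eq_square algebra_simps)
  then have "p * ((cmod z)\<^sup>2 + t\<^sup>2) + Im (B * z) + q =
      p * ((cmod (z - Complex u v))\<^sup>2 + t\<^sup>2 - ((cmod B)\<^sup>2 - 4 * p * q) / (4 * p\<^sup>2))" for z t
    unfolding R using p by (simp add: cmod_power2 B)
  then show ?thesis by blast
qed

text \<open>A zero of the form is not a local minimum. If \<open>p = 0\<close>, a horizontal step
  along \<open>- \<i> * cnj B\<close> lowers \<open>Im (B * z)\<close>; otherwise a vertical step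
  works, because \<open>t\<^sup>2\<close> is strictly monotone for positive
  \<open>t\<close>.\<close>

lemma form_crosses:
  assumes t: "0 < t" and e: "0 < e" and zero: "p * ((cmod z)\<^sup>2 + t\<^sup>2) + Im (B * z) + q = 0"
    and pB: "p \<noteq> 0 \<or> B \<noteq> 0"
  shows "\<exists>z' t'. 0 < t' \<and> dist (z', t') (z, t) < e \<and> p * ((cmod z')\<^sup>2 + t'\<^sup>2) + Im (B * z') + q < (0::real)"
proof (cases "p = 0")
  case True
  then have B: "B \<noteq> 0" using pB by simp
  define s where "s = e / (2 * cmod B)"
  have s: "0 < s" using B e by (simp add: s_def)
  have "dist (z - of_real s * \<i> * cnj B, t) (z, t) = s * cmod B"
    using s by (simp add: dist_norm norm_Pair norm_mult)
  also have "\<dots> < e" using B e by (simp add: s_def)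
  finally have dist: "dist (z - of_real s * \<i> * cnj B, t) (z, t) < e" .
  have "Im (B * (z - of_real s * \<i> * cnj B)) = Im (B * z) - s * (cmod B)\<^sup>2"
    unfolding cmod_power2 by (simp add: power2_eq_square algebra_simps)
  moreover have "0 < s * (cmod B)\<^sup>2" using B s by simp
  ultimately have "Im (B * (z - of_real s * \<i> * cnj B)) + q < 0" using zero True by simp
  then show ?thesis
    using dist t True by (intro exI[of _ "z - of_real s * \<i> * cnj B"] exI[of _ t]) simp
next
  case False
  \<comment> \<open>The bound \<open>t / 2\<close> keeps the moved point in the upper
    half-space.\<close>
  define s where "s = min (e / 2) (t / 2)"
  have s: "0 < s" "s < e" "s < t" using e t by (auto simp: s_def)
  define t' where "t' = (if 0 < p then t - s else t + s)"
  have t': "0 < t'" "dist (z, t') (z, t) < e"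
    using s t by (auto simp: t'_def dist_norm norm_Pair)
  have "p * (t'\<^sup>2 - t\<^sup>2) = p * (t' - t) * (t' + t)" by (simp add: power2_eq_square algebra_simps)
  moreover have "p * (t' - t) < 0"
    using False s by (auto simp: t'_def mult_less_0_iff)
  moreover have "0 < t' + t" using t' t by simp
  ultimately have "p * (t'\<^sup>2 - t\<^sup>2) < 0" using mult_neg_pos[of "p * (t' - t)" "t' + t"] by linarith
  then have "p * ((cmod z)\<^sup>2 + t'\<^sup>2) + Im (B * z) + q < 0" using zero by (simp add: algebra_simps)
  then show ?thesis using t' by blast
qed

text \<open>For nonzero \<open>\<delta>\<close> this says that \<open>(z - l) / \<delta>\<close> is
  real; the form with \<open>cnj \<delta>\<close> matches \<open>mirror_form\<close>.\<close>

definition line_through :: "complex \<Rightarrow> complex \<Rightarrow> complex set" where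
  "line_through l \<delta> = {z. Im (cnj \<delta> * (z - l)) = 0}"

lemma line_through_minus: "line_through l (- \<delta>) = line_through l \<delta>"
  by (auto simp: line_through_def)

lemma affine_hull_line_through:
  assumes "a \<noteq> b"
  shows "affine hull {a, b} = line_through a (b - a)"
proof (intro set_eqI iffI)
  fix z assume "z \<in> affine hull {a, b}"
  then obtain u v where uv: "u + v = 1" "z = u *\<^sub>R a + v *\<^sub>R b" by (auto simp: affine_hull_2)
  then have u: "u = 1 - v" by simp
  have *: "z - a = v *\<^sub>R (b - a)" unfolding uv(2) u by (simp add: algebra_simps)
  show "z \<in> line_through a (b - a)"
    unfolding line_through_def mem_Collect_eq * by (simp add: algebra_simps)
next
  fix z assume "z \<in> line_through a (b - a)"
  then have im: "Im (cnj (b - a) * (z - a)) = 0" by (simp add: line_through_def)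
  \<comment> \<open>The coordinate of the orthogonal projection of \<open>z\<close> to the line,
    measured from \<open>a\<close> in units of \<open>b - a\<close>.\<close>
  define v where "v = Re (cnj (b - a) * (z - a)) / (cmod (b - a))\<^sup>2"
  have n: "cmod (b - a) \<noteq> 0" using assms by simp
  have "cnj (b - a) * (z - a) = of_real (v * (cmod (b - a))\<^sup>2)"
    using im n by (simp add: v_def complex_eq_iff del: norm_eq_zero)
  also have "\<dots> = cnj (b - a) * (of_real v * (b - a))"
    by (simp add: complex_norm_square mult_ac del: of_real_power flip: of_real_power)
  finally have "z - a = of_real v * (b - a)" using assms by simp
  then have "z = (1 - v) *\<^sub>R a + v *\<^sub>R b" by (simp add: algebra_simps scaleR_conv_of_real)
  then show "z \<in> affine hull {a, b}"
    unfolding affine_hull_2 mem_Collect_eq by (metis diff_add_cancel)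
qed

section \<open>Base polygon and edge lines in lattice coordinates\<close>

context bianchi begin

text \<open>The rectangle lies in four half-planes, and conversely each of its points is a convex
  combination of points on two opposite edges. For the triangle, \<open>x\<close> and
  \<open>y\<close> are barycentric coordinates.\<close>

lemma base_polygon_iff: "pt x y \<in> base_polygon d \<longleftrightarrow> in_base x y"
proof (cases "d \<in> {1, 2}")
  case True
  then have tr: "tr = 0" by (simp add: tr_def)
  have poly: "base_polygon d = convex hull {0, 1, omega d, omega d + 1}" using True by (auto simp: base_polygon_def)
  show ?thesis
  proof
    let ?R = "{z. 0 \<le> Re z} \<inter> {z. Re z \<le> 1} \<inter> {z. 0 \<le> Im z} \<inter> {z. Im z \<le> \<eta>}"
    have "convex ?R"
      by (intro convex_Int convex_halfspace_Re_ge convex_halfspace_Re_le convex_halfspace_Im_ge convex_halfspace_Im_le)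
    moreover have "{0, 1, omega d, omega d + 1} \<subseteq> ?R"
      using eta_pos by (auto simp: Re_omega tr \<eta>_def)
    ultimately have "base_polygon d \<subseteq> ?R" unfolding poly by (rule hull_minimal[rotated])
    moreover assume "pt x y \<in> base_polygon d"
    ultimately show "in_base x y" using eta_pos by (auto simp: in_base_def Re_pt Im_pt tr zero_le_mult_iff)
  next
    assume W: "in_base x y"
    have cvx: "convex (base_polygon d)" unfolding poly by (rule convex_convex_hull)
    have mem: "0 \<in> base_polygon d" "1 \<in> base_polygon d" "omega d \<in> base_polygon d" "omega d + 1 \<in> base_polygon d"
      unfolding poly by (auto intro: hull_inc)
    have "(1 - x) *\<^sub>R 0 + x *\<^sub>R 1 \<in> base_polygon d" "(1 - x) *\<^sub>R omega d + x *\<^sub>R (omega d + 1) \<in> base_polygon d"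
      by (rule convexD[OF cvx]; use W mem tr in \<open>simp add: in_base_def\<close>)+
    then have "(1 - y) *\<^sub>R ((1 - x) *\<^sub>R 0 + x *\<^sub>R 1) + y *\<^sub>R ((1 - x) *\<^sub>R omega d + x *\<^sub>R (omega d + 1)) \<in> base_polygon d"
      by (rule convexD[OF cvx]; use W tr in \<open>simp add: in_base_def\<close>)
    also have "(1 - y) *\<^sub>R ((1 - x) *\<^sub>R 0 + x *\<^sub>R 1) + y *\<^sub>R ((1 - x) *\<^sub>R omega d + x *\<^sub>R (omega d + 1)) = pt x y"
      by (simp add: pt_def scaleR_conv_of_real algebra_simps)
    finally show "pt x y \<in> base_polygon d" .
  qed
next
  case False
  then have tr: "tr = 1" by (simp add: tr_def)
  have poly: "base_polygon d = convex hull {0, 1, omega d}" using False by (auto simp: base_polygon_def)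
  have comb: "u *\<^sub>R 0 + v *\<^sub>R 1 + w *\<^sub>R omega d = pt v w" for u v w
    by (simp add: pt_def scaleR_conv_of_real)
  have "pt x y \<in> base_polygon d \<longleftrightarrow> (\<exists>u v w. 0 \<le> u \<and> 0 \<le> v \<and> 0 \<le> w \<and> u + v + w = 1 \<and> pt x y = pt v w)"
    unfolding poly convex_hull_3 comb by auto
  also have "\<dots> \<longleftrightarrow> in_base x y"
    unfolding pt_eq_iff in_base_def tr by (auto intro!: exI[of _ "1 - x - y"])
  finally show ?thesis .
qed

text \<open>Up to sign, \<open>cnj (omega d)\<close> is the third edge direction of the triangle,
  and it is \<open>omega d\<close> itself for rectangles. The set is closed under conjugation, as
  the conjugate cells require.\<close>

definition dirs :: "complex set" where "dirs = {1, omega d, cnj (omega d)}"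

lemma dirs_Z_omega: "\<delta> \<in> dirs \<Longrightarrow> \<delta> \<in> Z_omega d"
  by (auto simp: dirs_def Z_omega_cnj)

lemma dirs_cnj: "\<delta> \<in> dirs \<Longrightarrow> cnj \<delta> \<in> dirs"
  by (auto simp: dirs_def)

lemma dirs_norm:
  assumes "\<delta> \<in> dirs"
  obtains N where "(cmod \<delta>)\<^sup>2 = of_int N" "N = 1 \<or> N = nm"
proof -
  have "(cmod (omega d))\<^sup>2 = nm" using cmod_pt[of 0 1] by (simp add: pt_def)
  then show ?thesis using assms that[of 1] that[of nm] by (auto simp: dirs_def)
qed

lemma dirs_nonzero: "\<delta> \<in> dirs \<Longrightarrow> \<delta> \<noteq> 0"
  using eta_pos unfolding dirs_def \<eta>_def by auto

lemma edge_lines_eq: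
  "edge_lines d = (if d \<in> {1, 2}
     then {line_through 0 1, line_through 1 (omega d), line_through (omega d) 1, line_through 0 (omega d)}
     else {line_through 0 1, line_through 1 (cnj (omega d)), line_through 0 (omega d)})"
proof -
  have ne: "omega d \<noteq> 0" "omega d \<noteq> 1" using eta_pos by (auto simp: \<eta>_def)
  have "line_through 1 (cnj (omega d)) = line_through 1 (omega d - 1)" if "d \<notin> {1, 2}"
    using line_through_minus[of 1 "cnj (omega d)"] that by (simp add: cnj_omega tr_def)
  then show ?thesis
    using ne by (simp add: edge_lines_def affine_hull_line_through)
qed

lemma edge_linesE:
  assumes "L \<in> edge_lines d"
  obtains l \<delta> where "l \<in> Z_omega d" "\<delta> \<in> dirs" "L = line_through l \<delta>"
proof -
  have "L = line_through 0 1 \<or> L = line_through 1 (omega d) \<or> L = line_through (omega d) 1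
      \<or> L = line_through 0 (omega d) \<or> L = line_through 1 (cnj (omega d))"
    using assms unfolding edge_lines_eq by (simp split: if_splits) blast+
  moreover have "1 \<in> dirs" "omega d \<in> dirs" "cnj (omega d) \<in> dirs" by (simp_all add: dirs_def)
  ultimately show ?thesis using that Z_omega_0_1 omega_Z_omega by blast
qed

lemma dirs_edge_line:
  assumes "\<delta> \<in> dirs"
  obtains l where "l \<in> Z_omega d" "line_through l \<delta> \<in> edge_lines d"
proof -
  have "line_through 0 (cnj (omega d)) = line_through 0 (omega d)" if "d \<in> {1, 2}"
    using that line_through_minus[of 0 "omega d"] by (simp add: cnj_omega tr_def)
  then have "line_through (if d \<in> {1, 2} then 0 else 1) (cnj (omega d)) \<in> edge_lines d"
    by (simp add: edge_lines_eq)
  moreover have "line_through 0 1 \<in> edge_lines d" "line_through 0 (omega d) \<in> edge_lines d"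
    by (simp_all add: edge_lines_eq)
  moreover have "(if d \<in> {1, 2} then 0 else 1) \<in> Z_omega d" by simp
  ultimately show ?thesis using assms that Z_omega_0_1 unfolding dirs_def by blast
qed

section \<open>Integral mirror forms and the images of walls\<close>

text \<open>\<open>lead\<close>, \<open>mid\<close> and \<open>cst\<close> are the coefficients
  \<open>p\<close>, \<open>B\<close> and \<open>q\<close> of \<open>mirror_form\<close>. The zero
  set is a vertical half-plane exactly if \<open>lead\<close> vanishes (for \<open>\<delta>\<close>
  in \<open>dirs\<close> and \<open>A\<close> in \<open>SL2 d\<close>).\<close>

definition lead :: "complex \<Rightarrow> complex^2^2 \<Rightarrow> real" where
  "lead \<delta> A = Im (cnj \<delta> * A $ 1 $ 1 * cnj (A $ 2 $ 1))"

definition mid :: "complex \<Rightarrow> complex^2^2 \<Rightarrow> complex" where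
  "mid \<delta> A = cnj \<delta> * A $ 1 $ 1 * cnj (A $ 2 $ 2) - \<delta> * cnj (A $ 1 $ 2) * A $ 2 $ 1"

definition cst :: "complex \<Rightarrow> complex^2^2 \<Rightarrow> real" where
  "cst \<delta> A = Im (cnj \<delta> * A $ 1 $ 2 * cnj (A $ 2 $ 2))"

lemma mirror_form_SL2:
  "A \<in> SL2 d \<Longrightarrow> 0 < t \<Longrightarrow>
    mirror_form \<delta> A (z, t) = lead \<delta> A * ((cmod z)\<^sup>2 + t\<^sup>2) + Im (mid \<delta> A * z) + cst \<delta> A"
  unfolding lead_def mid_def cst_def by (intro mirror_form_eq) (simp_all add: SL2_det)

lemma discriminant_SL2:
  "A \<in> SL2 d \<Longrightarrow> (cmod (mid \<delta> A))\<^sup>2 - 4 * lead \<delta> A * cst \<delta> A = (cmod \<delta>)\<^sup>2"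
  unfolding lead_def mid_def cst_def mirror_form_discriminant by (simp add: SL2_iff)

lemma form_coefficients_integral:
  assumes A: "A \<in> SL2 d" and \<delta>: "\<delta> \<in> dirs"
  shows "mid \<delta> A \<in> Z_omega d" "\<exists>l::int. cst \<delta> A = \<eta> * l" "\<exists>j::int. lead \<delta> A = \<eta> * j"
proof -
  note ring = Z_omega_mult Z_omega_cnj Z_omega_diff
  have Z: "A $ 1 $ 1 \<in> Z_omega d" "A $ 1 $ 2 \<in> Z_omega d" "A $ 2 $ 1 \<in> Z_omega d" "A $ 2 $ 2 \<in> Z_omega d"
    "\<delta> \<in> Z_omega d"
    using A dirs_Z_omega[OF \<delta>] by (auto simp: SL2_iff)
  show "mid \<delta> A \<in> Z_omega d" unfolding mid_def using Z by (intro ring)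
  show "\<exists>l::int. cst \<delta> A = \<eta> * l"
    unfolding cst_def by (rule Im_Z_omega) (use Z in \<open>intro ring\<close>)
  show "\<exists>j::int. lead \<delta> A = \<eta> * j"
    unfolding lead_def by (rule Im_Z_omega) (use Z in \<open>intro ring\<close>)
qed

text \<open>Imaginary parts of ring elements are integral multiples of \<open>\<eta>\<close>, so
  after division by \<open>\<eta>\<close> the form has integral coefficients in lattice coordinates.
  Since \<open>4 * \<eta>\<^sup>2\<close> is \<open>disc\<close>, the discriminant identity becomes
  an equation between integers.\<close>

lemma mirror_form_coords:
  assumes A: "A \<in> SL2 d" and \<delta>: "\<delta> \<in> dirs"
  obtains j m n l N :: int where "lead \<delta> A = \<eta> * j" "N = 1 \<or> N = nm"
    "m\<^sup>2 + tr * m * n + nm * n\<^sup>2 - disc * j * l = N"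
    "\<And>(x::real) (y::real) t. 0 < t \<Longrightarrow> mirror_form \<delta> A (pt x y, t) =
       \<eta> * (j * (qf x y + t\<^sup>2) + (m * y + n * x + tr * n * y) + l)"
proof -
  obtain j l :: int where q: "cst \<delta> A = \<eta> * l" and j: "lead \<delta> A = \<eta> * j"
    using form_coefficients_integral[OF A \<delta>] by blast
  obtain m n where mn: "mid \<delta> A = pt (of_int m) (of_int n)"
    using form_coefficients_integral(1)[OF A \<delta>] by (auto simp: Z_omega_iff)
  obtain N where N: "(cmod \<delta>)\<^sup>2 = of_int N" "N = 1 \<or> N = nm" using dirs_norm[OF \<delta>] by blast
  have "4 * lead \<delta> A * cst \<delta> A = 4 * \<eta>\<^sup>2 * j * l" by (simp add: q j power2_eq_square)
  also have "\<dots> = disc * j * l" unfolding eta_square by (simp add: disc_def)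
  finally have "real_of_int (m\<^sup>2 + tr * m * n + nm * n\<^sup>2 - disc * j * l) = of_int N"
    using discriminant_SL2[OF A, of \<delta>] by (simp add: mn cmod_pt N(1))
  then have "m\<^sup>2 + tr * m * n + nm * n\<^sup>2 - disc * j * l = N" by (simp only: of_int_eq_iff)
  then show ?thesis
  proof (rule that[OF j N(2)])
    show "mirror_form \<delta> A (pt x y, t) =
      \<eta> * (j * (qf x y + t\<^sup>2) + (m * y + n * x + tr * n * y) + l)" if "0 < t" for x y t :: real
    using mirror_form_SL2[OF A that, of \<delta> "pt x y"]
    by (simp add: j q mn pt_mult Im_pt cmod_pt qf_def algebra_simps)
  qed
qed

text \<open>Raising a point moves it strictly away from every hemisphere that it is not inside;
  \<open>std_cell_eq\<close> uses this to approximate points of the cell.\<close>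

lemma lead_mult_form_raise:
  assumes A: "A \<in> SL2 d" and \<delta>: "\<delta> \<in> dirs" and "0 < t" "0 < e"
  shows "lead \<delta> A * mirror_form \<delta> A (z, t + e) =
    lead \<delta> A * mirror_form \<delta> A (z, t) + (lead \<delta> A)\<^sup>2 * (2 * t * e + e\<^sup>2)"
proof -
  have "mirror_form \<delta> A (z, t + e) = mirror_form \<delta> A (z, t) + lead \<delta> A * (2 * t * e + e\<^sup>2)"
    using assms by (simp add: mirror_form_SL2 power2_eq_square algebra_simps)
  then show ?thesis by (simp add: power2_eq_square algebra_simps)
qed

lemma continuous_on_mirror_form:
  assumes A: "A \<in> SL2 d" and \<delta>: "\<delta> \<in> dirs"
  shows "continuous_on H3 (mirror_form \<delta> A)"
proof -
  have "continuous_on H3 (\<lambda>w. lead \<delta> A * ((cmod (fst w))\<^sup>2 + (snd w)\<^sup>2) + Im (mid \<delta> A * fst w) + cst \<delta> A)"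
    by (intro continuous_intros)
  moreover have "mirror_form \<delta> A w = lead \<delta> A * ((cmod (fst w))\<^sup>2 + (snd w)\<^sup>2) + Im (mid \<delta> A * fst w) + cst \<delta> A"
    if "w \<in> H3" for w using mirror_form_SL2[OF A, of "snd w" \<delta> "fst w"] that by (simp add: H3_def)
  ultimately show ?thesis by (simp cong: continuous_on_cong)
qed

lemma mirror_form_zero_iff:
  assumes "A \<in> SL2 d" "w \<in> H3"
  shows "mirror_form \<delta> A w = 0 \<longleftrightarrow> Im (cnj \<delta> * fst (moebius A w)) = 0"
  using mden_pos[of A w] assms by (simp add: mirror_form_def SL2_det)

text \<open>A point lies in the image of the wall iff its image under the inverse \<open>B\<close>
  lies in the wall; the translation by \<open>- l\<close> then moves the line to the origin.\<close>

lemma wall_image: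
  assumes A: "A \<in> SL2 d" and B: "B \<in> SL2 d" and AB: "A ** B = mat 1" "B ** A = mat 1" and l: "l \<in> Z_omega d"
  shows "moebius A ` (line_through l \<delta> \<times> {0<..}) = {w \<in> H3. mirror_form \<delta> (mat2 1 (- l) 0 1 ** B) w = 0}"
proof -
  have T: "mat2 1 (- l) 0 1 \<in> SL2 d" using l by (intro translation_SL2 Z_omega_minus)
  have mem: "mirror_form \<delta> (mat2 1 (- l) 0 1 ** B) w = 0 \<longleftrightarrow> moebius B w \<in> line_through l \<delta> \<times> {0<..}"
    if w: "w \<in> H3" for w
  proof -
    obtain z t where zt: "moebius B w = (z, t)" by fastforce
    have "0 < t" using moebius_H3[OF B w] by (simp add: zt H3_def)
    moreover have "moebius (mat2 1 (- l) 0 1 ** B) w = (z - l, t)"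
      by (simp add: moebius_mult[OF SL2_det[OF T] SL2_det[OF B] w] zt moebius_translation)
    ultimately show ?thesis
      using mirror_form_zero_iff[OF SL2_mult[OF T B] w, of \<delta>] by (simp add: zt line_through_def)
  qed
  show ?thesis
  proof (intro set_eqI iffI)
    fix w assume "w \<in> moebius A ` (line_through l \<delta> \<times> {0<..})"
    then obtain v where v: "v \<in> line_through l \<delta> \<times> {0<..}" "w = moebius A v" by blast
    then have "v \<in> H3" by (auto simp: H3_def)
    then show "w \<in> {w \<in> H3. mirror_form \<delta> (mat2 1 (- l) 0 1 ** B) w = 0}"
      using v mem[of w] moebius_inverse[OF B A AB(2)] moebius_H3[OF A] by auto
  next
    fix w assume "w \<in> {w \<in> H3. mirror_form \<delta> (mat2 1 (- l) 0 1 ** B) w = 0}"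
    then have "w \<in> H3" "moebius B w \<in> line_through l \<delta> \<times> {0<..}" using mem[of w] by auto
    then show "w \<in> moebius A ` (line_through l \<delta> \<times> {0<..})"
      using moebius_inverse[OF A B AB(1)] by (metis imageI)
  qed
qed

lemma psl_act_wall:
  assumes "P \<in> PSL2 d" "X \<in> walls d"
  obtains A \<delta> where "A \<in> SL2 d" "\<delta> \<in> dirs" "psl_act P ` X = {w \<in> H3. mirror_form \<delta> A w = 0}"
proof -
  obtain A where A: "A \<in> SL2 d" "P = {A, - A}" using assms(1) by (auto simp: PSL2_eq)
  obtain B where B: "B \<in> SL2 d" "A ** B = mat 1" "B ** A = mat 1" using SL2_inverse[OF A(1)] by blast
  obtain l \<delta> where l: "l \<in> Z_omega d" "\<delta> \<in> dirs" "X = line_through l \<delta> \<times> {0<..}"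
    using assms(2) unfolding walls_def by (auto elim: edge_linesE)
  have "mat2 1 (- l) 0 1 ** B \<in> SL2 d"
    using l B by (intro SL2_mult translation_SL2 Z_omega_minus)
  then show ?thesis
    using wall_image[OF A(1) B l(1), of \<delta>] that l by (simp add: A(2) psl_act_class)
qed

lemma mirror_form_wall:
  assumes C: "C \<in> SL2 d" and \<delta>: "\<delta> \<in> dirs"
  obtains P X where "P \<in> PSL2 d" "X \<in> walls d" "psl_act P ` X = {w \<in> H3. mirror_form \<delta> C w = 0}"
proof -
  obtain l where l: "l \<in> Z_omega d" "line_through l \<delta> \<in> edge_lines d" using dirs_edge_line[OF \<delta>] by blast
  have T: "mat2 1 l 0 1 \<in> SL2 d" using l by (simp add: translation_SL2)
  have TT: "mat2 1 (- l) 0 1 ** mat2 1 l 0 1 = mat 1"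
    by (simp add: vec_eq_iff forall_2 matrix_matrix_mult_def sum_2 mat_def)
  have B: "mat2 1 l 0 1 ** C \<in> SL2 d" using T C by (rule SL2_mult)
  obtain A where A: "A \<in> SL2 d" "(mat2 1 l 0 1 ** C) ** A = mat 1" "A ** (mat2 1 l 0 1 ** C) = mat 1"
    using SL2_inverse[OF B] by blast
  have "moebius A ` (line_through l \<delta> \<times> {0<..}) = {w \<in> H3. mirror_form \<delta> C w = 0}"
    using wall_image[OF A(1) B A(3,2) l(1), of \<delta>] by (simp add: matrix_mul_assoc TT)
  then show ?thesis
    using that[of "{A, - A}" "line_through l \<delta> \<times> {0<..}"] A(1) l(2)
    by (auto simp: psl_act_class PSL2_eq walls_def)
qed

text \<open>A mirror form with leading coefficient \<open>p\<close> other than 0 equals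
  \<open>p (|z - c|^2 + t^2 - r^2)\<close> with \<open>r = |\<delta>| / (2 |p|)\<close>, so lying
  outside the ball means having the sign of \<open>p\<close>. The two sides match because zero sets
  of mirror forms are the images of walls, and a form vanishing on a hemisphere is determined up to
  scaling.\<close>

lemma above_hemispheres_iff:
  "w \<in> above_hemispheres d \<longleftrightarrow>
     w \<in> H3 \<and> (\<forall>A\<in>SL2 d. \<forall>\<delta>\<in>dirs. lead \<delta> A \<noteq> 0 \<longrightarrow> 0 < lead \<delta> A * mirror_form \<delta> A w)"
proof (intro iffI conjI ballI impI)
  assume w: "w \<in> above_hemispheres d"
  then show H: "w \<in> H3" by (simp add: above_hemispheres_def)
  fix A \<delta> assume A: "A \<in> SL2 d" and \<delta>: "\<delta> \<in> dirs" and p: "lead \<delta> A \<noteq> 0"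
  define r where "r = cmod \<delta> / (2 * \<bar>lead \<delta> A\<bar>)"
  have r: "0 < r" using p dirs_nonzero[OF \<delta>] by (simp add: r_def)
  have r2: "r\<^sup>2 = (cmod \<delta>)\<^sup>2 / (4 * (lead \<delta> A)\<^sup>2)" by (simp add: r_def power_divide power_mult_distrib)
  obtain c where center: "\<forall>z t. lead \<delta> A * ((cmod z)\<^sup>2 + t\<^sup>2) + Im (mid \<delta> A * z) + cst \<delta> A =
      lead \<delta> A * ((cmod (z - c))\<^sup>2 + t\<^sup>2 - ((cmod (mid \<delta> A))\<^sup>2 - 4 * lead \<delta> A * cst \<delta> A) / (4 * (lead \<delta> A)\<^sup>2))"
    using form_center[OF p] by blast
  have c: "mirror_form \<delta> A (z, t) = lead \<delta> A * ((cmod (z - c))\<^sup>2 + t\<^sup>2 - r\<^sup>2)" if "0 < t" for z t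
    by (simp only: mirror_form_SL2[OF A that] center[rule_format] discriminant_SL2[OF A] r2)
  have dist: "dist (c, 0) (z, t) = sqrt ((cmod (z - c))\<^sup>2 + t\<^sup>2)" for z and t :: real
    by (simp add: dist_norm norm_Pair norm_minus_commute)
  have sqrt: "sqrt s = r \<longleftrightarrow> s = r\<^sup>2" "r < sqrt s \<longleftrightarrow> r\<^sup>2 < s" for s
    using real_sqrt_eq_iff[of s "r\<^sup>2"] real_sqrt_less_iff[of "r\<^sup>2" s] r by simp_all
  have "mirror_form \<delta> A v = 0 \<longleftrightarrow> v \<in> sphere (c, 0) r" if "v \<in> H3" for v
    using that p by (cases v) (simp add: H3_def c dist sqrt)
  then have hemi: "{w \<in> H3. mirror_form \<delta> A w = 0} = hemisphere c r"
    by (auto simp: hemisphere_def)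
  obtain P X where PX: "P \<in> PSL2 d" "X \<in> walls d" "psl_act P ` X = {w \<in> H3. mirror_form \<delta> A w = 0}"
    by (rule mirror_form_wall[OF A \<delta>])
  have "w \<notin> cball (c, 0) r"
    using w r PX(1,2) PX(3)[unfolded hemi] unfolding above_hemispheres_def by blast
  moreover obtain z t where zt: "w = (z, t)" "0 < t" using H by (cases w) (auto simp: H3_def)
  ultimately have "r < sqrt ((cmod (z - c))\<^sup>2 + t\<^sup>2)" by (simp add: dist)
  then have "0 < (cmod (z - c))\<^sup>2 + t\<^sup>2 - r\<^sup>2" by (simp add: sqrt)
  then have "0 < (lead \<delta> A)\<^sup>2 * ((cmod (z - c))\<^sup>2 + t\<^sup>2 - r\<^sup>2)" using p by simp
  then show "0 < lead \<delta> A * mirror_form \<delta> A w" by (simp add: zt c power2_eq_square mult.assoc)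
next
  assume w: "w \<in> H3 \<and> (\<forall>A\<in>SL2 d. \<forall>\<delta>\<in>dirs. lead \<delta> A \<noteq> 0 \<longrightarrow> 0 < lead \<delta> A * mirror_form \<delta> A w)"
  obtain z t where zt: "w = (z, t)" "0 < t" using w by (cases w) (auto simp: H3_def)
  have "w \<notin> cball (c, 0) r"
    if P: "P \<in> PSL2 d" and X: "X \<in> walls d" and r: "0 < r" and im: "psl_act P ` X = hemisphere c r" for P X c r
  proof -
    obtain A \<delta> where A: "A \<in> SL2 d" and \<delta>: "\<delta> \<in> dirs" and img: "psl_act P ` X = {w \<in> H3. mirror_form \<delta> A w = 0}"
      using psl_act_wall[OF P X] by blast
    have "lead \<delta> A * ((cmod z)\<^sup>2 + t\<^sup>2) + Im (mid \<delta> A * z) + cst \<delta> A = 0" if "(z, t) \<in> hemisphere c r" for z t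
    proof -
      have "(z, t) \<in> {w \<in> H3. mirror_form \<delta> A w = 0}" using that im img by simp
      then show ?thesis using mirror_form_SL2[OF A, of t \<delta> z] by (simp add: H3_def)
    qed
    then have eq: "lead \<delta> A * ((cmod z)\<^sup>2 + t\<^sup>2) + Im (mid \<delta> A * z) + cst \<delta> A =
        lead \<delta> A * ((cmod (z - c))\<^sup>2 + t\<^sup>2 - r\<^sup>2)" for z t
      by (rule hemisphere_form_eq[OF r])
    \<comment> \<open>Otherwise the form vanishes identically, which contradicts its nonzero
      discriminant.\<close>
    have p: "lead \<delta> A \<noteq> 0"
    proof
      assume p: "lead \<delta> A = 0"
      then have "Im (mid \<delta> A * u) + cst \<delta> A = 0" for u using eq[of u] by simp
      from this[of 0] this[of 1] this[of \<i>] have "mid \<delta> A = 0" by (simp add: complex_eq_iff)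
      then show False using discriminant_SL2[OF A, of \<delta>] p dirs_nonzero[OF \<delta>] by simp
    qed
    have "0 < lead \<delta> A * mirror_form \<delta> A w" using w A \<delta> p by blast
    then have "0 < lead \<delta> A * (lead \<delta> A * ((cmod (z - c))\<^sup>2 + t\<^sup>2 - r\<^sup>2))"
      using mirror_form_SL2[OF A zt(2), of \<delta> z] eq[of z t] by (simp add: zt)
    then have "0 < (lead \<delta> A)\<^sup>2 * ((cmod (z - c))\<^sup>2 + t\<^sup>2 - r\<^sup>2)" by (simp add: power2_eq_square mult.assoc)
    then have "r\<^sup>2 < (cmod (z - c))\<^sup>2 + t\<^sup>2" by (simp add: zero_less_mult_iff)
    then have "r < sqrt ((cmod (z - c))\<^sup>2 + t\<^sup>2)" by (rule real_less_rsqrt)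
    then show ?thesis by (simp add: zt dist_norm norm_Pair norm_minus_commute)
  qed
  then show "w \<in> above_hemispheres d" using w unfolding above_hemispheres_def by blast
qed

subsection \<open>The standard cell\<close>

text \<open>Taking the closure relaxes the strict inequalities: the right side is closed in
  \<open>H3\<close>, and each of its points is the limit of the points vertically above it, which
  satisfy the strict ones.\<close>

lemma std_cell_eq:
  "std_cell d = {w \<in> H3. fst w \<in> base_polygon d \<and> (\<forall>A\<in>SL2 d. \<forall>\<delta>\<in>dirs. 0 \<le> lead \<delta> A * mirror_form \<delta> A w)}"
    (is "_ = ?K")
proof
  let ?C = "base_polygon d \<times> {0<..} \<inter> above_hemispheres d"
  have C: "?C \<subseteq> ?K"
    by (force simp: above_hemispheres_iff H3_def)
  have "closedin (top_of_set H3) ?K"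
  proof -
    define F where "F = insert (H3 \<inter> fst -` base_polygon d)
      ((\<lambda>(A, \<delta>). H3 \<inter> (\<lambda>w. lead \<delta> A * mirror_form \<delta> A w) -` {0..}) ` (SL2 d \<times> dirs))"
    have "compact (base_polygon d)"
      unfolding base_polygon_def by (auto intro!: finite_imp_compact_convex_hull)
    then have "closed (base_polygon d)" by (rule compact_imp_closed)
    then have "closedin (top_of_set H3) S" if "S \<in> F" for S
      using that unfolding F_def
      by (auto intro!: continuous_closedin_preimage continuous_intros continuous_on_mirror_form)
    then have "closedin (top_of_set H3) (\<Inter>F)" by (intro closedin_Inter) (auto simp: F_def)
    moreover have "\<Inter>F = ?K" by (auto simp: F_def)
    ultimately show ?thesis by simp
  qed
  then show "std_cell d \<subseteq> ?K" unfolding std_cell_def using C by (intro closure_of_minimal)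
  show "?K \<subseteq> std_cell d"
  proof
    fix w assume w: "w \<in> ?K"
    then obtain z t where zt: "w = (z, t)" "0 < t" by (cases w) (auto simp: H3_def)
    have raise: "(z, t + e) \<in> ?C" if e: "0 < e" for e
    proof -
      have "0 < lead \<delta> A * mirror_form \<delta> A (z, t + e)"
        if A: "A \<in> SL2 d" and \<delta>: "\<delta> \<in> dirs" and p: "lead \<delta> A \<noteq> 0" for A \<delta>
      proof -
        have "0 < (lead \<delta> A)\<^sup>2 * (2 * t * e + e\<^sup>2)"
          using p zt(2) e by (intro mult_pos_pos add_pos_pos) simp_all
        moreover have "0 \<le> lead \<delta> A * mirror_form \<delta> A (z, t)" using w A \<delta> by (simp add: zt)
        ultimately show ?thesis unfolding lead_mult_form_raise[OF A \<delta> zt(2) e] by linarith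
      qed
      then show ?thesis using w zt e by (auto simp: above_hemispheres_iff H3_def)
    qed
    have "w \<in> closure ?C"
    proof (unfold closure_approachable, intro allI impI)
      fix e :: real assume e: "0 < e"
      show "\<exists>y\<in>?C. dist y w < e"
        using e by (intro bexI[OF _ raise[of "e / 2"]]) (simp_all add: zt dist_norm norm_Pair)
    qed
    moreover have "H3 \<inter> ?C = ?C" by (auto simp: above_hemispheres_iff)
    ultimately show "w \<in> std_cell d"
      using w unfolding std_cell_def closure_of_subtopology by simp
  qed
qed

text \<open>Without the factor \<open>mden\<close>, composing with a group element gives exactly
  another member of the family. The sign \<open>s\<close> provides both half-spaces of each zero
  set.\<close>

definition mirrors :: "(point3 \<Rightarrow> real) set" where
  "mirrors = {\<lambda>w. s * Im (cnj \<delta> * fst (moebius A w)) | s \<delta> A. s \<in> {1, -1} \<and> \<delta> \<in> dirs \<and> A \<in> SL2 d}"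

lemma mirrorsI: "s = 1 \<or> s = -1 \<Longrightarrow> \<delta> \<in> dirs \<Longrightarrow> A \<in> SL2 d \<Longrightarrow> (\<lambda>w. s * Im (cnj \<delta> * fst (moebius A w))) \<in> mirrors"
  unfolding mirrors_def by blast

lemma mirrorsE:
  assumes "\<phi> \<in> mirrors"
  obtains s \<delta> A where "s = 1 \<or> s = -1" "\<delta> \<in> dirs" "A \<in> SL2 d" "\<phi> = (\<lambda>w. s * Im (cnj \<delta> * fst (moebius A w)))"
  using assms unfolding mirrors_def by blast

lemma mirror_mult_mden: "s * Im (cnj \<delta> * fst (moebius A w)) * mden A w = s * mirror_form \<delta> A w"
  by (simp add: mirror_form_def)

lemma mirror_sign:
  fixes s :: real
  assumes "A \<in> SL2 d" "w \<in> H3"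
  shows "0 \<le> s * Im (cnj \<delta> * fst (moebius A w)) \<longleftrightarrow> 0 \<le> s * mirror_form \<delta> A w"
    "s * Im (cnj \<delta> * fst (moebius A w)) < 0 \<longleftrightarrow> s * mirror_form \<delta> A w < 0"
proof -
  have m: "0 < mden A w" using assms by (simp add: mden_pos SL2_det)
  show "0 \<le> s * Im (cnj \<delta> * fst (moebius A w)) \<longleftrightarrow> 0 \<le> s * mirror_form \<delta> A w"
    "s * Im (cnj \<delta> * fst (moebius A w)) < 0 \<longleftrightarrow> s * mirror_form \<delta> A w < 0"
    unfolding mirror_mult_mden[symmetric] using m
    by (simp_all only: zero_le_mult_iff mult_less_0_iff) auto
qed

lemma mirrors_closedin:
  assumes "\<phi> \<in> mirrors"
  shows "closedin (top_of_set H3) {w \<in> H3. 0 \<le> \<phi> w}"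
proof -
  obtain s \<delta> A where \<delta>: "\<delta> \<in> dirs" and A: "A \<in> SL2 d" and \<phi>: "\<phi> = (\<lambda>w. s * Im (cnj \<delta> * fst (moebius A w)))"
    using assms by (rule mirrorsE)
  have "{w \<in> H3. 0 \<le> \<phi> w} = H3 \<inter> (\<lambda>w. s * mirror_form \<delta> A w) -` {0..}"
    using mirror_sign(1)[OF A] unfolding \<phi> by auto
  also have "closedin (top_of_set H3) \<dots>"
    by (intro continuous_closedin_preimage continuous_intros continuous_on_mirror_form A \<delta> closed_atLeast)
  finally show ?thesis .
qed

text \<open>The nonzero discriminant excludes that \<open>lead\<close> and \<open>mid\<close> both
  vanish, so \<open>form_crosses\<close> applies, with \<open>s\<close> absorbed into the
  coefficients.\<close>

lemma mirrors_cross: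
  assumes "\<phi> \<in> mirrors" "w \<in> H3" "\<phi> w = 0" "0 < e"
  shows "\<exists>v\<in>H3. dist v w < e \<and> \<phi> v < 0"
proof -
  obtain s \<delta> A where s: "s = 1 \<or> s = -1" and \<delta>: "\<delta> \<in> dirs" and A: "A \<in> SL2 d"
    and \<phi>: "\<phi> = (\<lambda>w. s * Im (cnj \<delta> * fst (moebius A w)))"
    using assms(1) by (rule mirrorsE)
  obtain z t where zt: "w = (z, t)" "0 < t" using assms(2) by (cases w) (auto simp: H3_def)
  have form: "s * mirror_form \<delta> A (z, t) = s * lead \<delta> A * ((cmod z)\<^sup>2 + t\<^sup>2) + Im (of_real s * mid \<delta> A * z) + s * cst \<delta> A"
    if "0 < t" for z t
    using mirror_form_SL2[OF A that, of \<delta> z] by (simp add: algebra_simps)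
  have "s * mirror_form \<delta> A w = 0"
    using assms(3) unfolding \<phi> mirror_mult_mden[symmetric] by simp
  then have zero: "s * lead \<delta> A * ((cmod z)\<^sup>2 + t\<^sup>2) + Im (of_real s * mid \<delta> A * z) + s * cst \<delta> A = 0"
    using form[OF zt(2)] by (simp only: zt(1))
  have "lead \<delta> A \<noteq> 0 \<or> mid \<delta> A \<noteq> 0"
    using discriminant_SL2[OF A, of \<delta>] dirs_nonzero[OF \<delta>] by auto
  then have "s * lead \<delta> A \<noteq> 0 \<or> of_real s * mid \<delta> A \<noteq> 0" using s by auto
  then obtain z' t' where v: "0 < t'" "dist (z', t') (z, t) < e"
    "s * lead \<delta> A * ((cmod z')\<^sup>2 + t'\<^sup>2) + Im (of_real s * mid \<delta> A * z') + s * cst \<delta> A < 0"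
    using form_crosses[OF zt(2) assms(4) zero] by blast
  have "s * mirror_form \<delta> A (z', t') < 0" unfolding form[OF v(1)] by (rule v(3))
  moreover have H: "(z', t') \<in> H3" using v(1) by (simp add: H3_def)
  ultimately have "\<phi> (z', t') < 0" unfolding \<phi> mirror_sign(2)[OF A H] by simp
  then show ?thesis using v(2) H zt(1) by blast
qed

lemma mirrors_moebius:
  assumes "\<phi> \<in> mirrors" and C: "C \<in> SL2 d"
  shows "\<exists>\<psi>\<in>mirrors. \<forall>w\<in>H3. \<psi> w = \<phi> (moebius C w)"
proof -
  obtain s \<delta> A where s: "s = 1 \<or> s = -1" and \<delta>: "\<delta> \<in> dirs" and A: "A \<in> SL2 d"
    and \<phi>: "\<phi> = (\<lambda>w. s * Im (cnj \<delta> * fst (moebius A w)))"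
    using assms(1) by (rule mirrorsE)
  show ?thesis
    by (rule bexI[OF _ mirrorsI[OF s \<delta> SL2_mult[OF A C]]]) (simp add: \<phi> moebius_mult SL2_det A C)
qed

definition conj_pt :: "point3 \<Rightarrow> point3" where "conj_pt = (\<lambda>(z, y). (cnj z, y))"

lemma conj_pt_H3: "w \<in> H3 \<Longrightarrow> conj_pt w \<in> H3" and conj_pt_conj_pt: "conj_pt (conj_pt w) = w"
  by (auto simp: conj_pt_def H3_def split: prod.splits)

text \<open>Conjugation passes to the entries of \<open>A\<close> and to \<open>\<delta>\<close>;
  since it negates imaginary parts, \<open>s\<close> changes sign.\<close>

lemma mirrors_conj:
  assumes "\<phi> \<in> mirrors"
  shows "\<exists>\<psi>\<in>mirrors. \<forall>w\<in>H3. \<psi> w = \<phi> (conj_pt w)"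
proof -
  obtain s \<delta> A where s: "s = 1 \<or> s = -1" and \<delta>: "\<delta> \<in> dirs" and A: "A \<in> SL2 d"
    and \<phi>: "\<phi> = (\<lambda>w. s * Im (cnj \<delta> * fst (moebius A w)))"
    using assms by (rule mirrorsE)
  define A' where "A' = mat2 (cnj (A $ 1 $ 1)) (cnj (A $ 1 $ 2)) (cnj (A $ 2 $ 1)) (cnj (A $ 2 $ 2))"
  have "cnj (A $ 1 $ 1 * A $ 2 $ 2 - A $ 1 $ 2 * A $ 2 $ 1) = 1" using A by (simp add: SL2_iff)
  then have A': "A' \<in> SL2 d" using A by (simp add: SL2_iff A'_def Z_omega_cnj)
  have "fst (moebius A (cnj z, t)) = cnj (fst (moebius A' (z, t)))" for z t
  proof -
    have "cmod (A $ 2 $ 1 * cnj z + A $ 2 $ 2) = cmod (cnj (A $ 2 $ 1 * cnj z + A $ 2 $ 2))"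
      by (simp only: complex_mod_cnj)
    then have "mden A (cnj z, t) = mden A' (z, t)" by (simp add: mden_def A'_def)
    then show ?thesis by (simp add: fst_moebius A'_def)
  qed
  then have *: "- s * Im (cnj (cnj \<delta>) * fst (moebius A' w)) = \<phi> (conj_pt w)" for w
    by (cases w) (simp add: \<phi> conj_pt_def algebra_simps)
  have "- s = 1 \<or> - s = -1" using s by auto
  from mirrorsI[OF this dirs_cnj[OF \<delta>] A'] show ?thesis by (rule bexI[rotated]) (use * in blast)
qed

text \<open>One-sidedness holds by \<open>std_cell_eq\<close> for hemispheres and by
  \<open>vertical_sign\<close> for vertical planes. Completeness holds because the edges of the base
  polygon and all hemispheres are themselves zero sets of mirrors.\<close>

lemma std_cell_mirror_cell: "mirror_cell mirrors (std_cell d)"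
proof -
  let ?K = "std_cell d"
  have K_H3: "?K \<subseteq> H3" by (auto simp: std_cell_eq)
  have K_base: "in_base x y" if "(pt x y, t) \<in> ?K" for x y t
    using that by (simp add: std_cell_eq base_polygon_iff)
  have sign: "(\<forall>v\<in>?K. 0 \<le> \<phi> v) \<or> (\<forall>v\<in>?K. \<phi> v \<le> 0)" if \<phi>0: "\<phi> \<in> mirrors" for \<phi>
  proof -
    obtain s \<delta> A where s: "s = 1 \<or> s = -1" and \<delta>: "\<delta> \<in> dirs" and A: "A \<in> SL2 d"
      and \<phi>: "\<phi> = (\<lambda>w. s * Im (cnj \<delta> * fst (moebius A w)))"
      using \<phi>0 by (rule mirrorsE)
    have "(\<forall>v\<in>?K. 0 \<le> mirror_form \<delta> A v) \<or> (\<forall>v\<in>?K. mirror_form \<delta> A v \<le> 0)"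
    proof (cases "lead \<delta> A = 0")
      case False
      have "\<forall>v\<in>?K. 0 \<le> lead \<delta> A * mirror_form \<delta> A v" using A \<delta> by (simp add: std_cell_eq)
      then show ?thesis using False by (cases "0 < lead \<delta> A") (auto simp: zero_le_mult_iff)
    next
      case True
      obtain j m n l N :: int where j: "lead \<delta> A = \<eta> * j" and N: "N = 1 \<or> N = nm"
        and disc: "m\<^sup>2 + tr * m * n + nm * n\<^sup>2 - disc * j * l = N"
        and form: "\<And>(x::real) (y::real) t. 0 < t \<Longrightarrow> mirror_form \<delta> A (pt x y, t) =
          \<eta> * (j * (qf x y + t\<^sup>2) + (m * y + n * x + tr * n * y) + l)"
        using mirror_form_coords[OF A \<delta>] by metis
      have j0: "j = 0" using j True eta_pos by simp
      then have eq: "m\<^sup>2 + tr * m * n + nm * n\<^sup>2 = N" using disc by simp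
      have val: "\<exists>(x::real) (y::real). in_base x y \<and> mirror_form \<delta> A v = \<eta> * (m * y + n * x + tr * n * y + l)" if "v \<in> ?K" for v
      proof -
        obtain x y t where v: "v = (pt x y, t)" by (metis pt_surj surj_pair)
        have "0 < t" using that K_H3 v by (auto simp: H3_def)
        then show ?thesis using K_base[of x y t] that form[of t x y] j0 v by auto
      qed
      from vertical_sign[OF eq N, of l] show ?thesis
      proof
        assume *: "\<forall>(x::real) (y::real). in_base x y \<longrightarrow> 0 \<le> m * y + n * x + tr * n * y + l"
        have "0 \<le> mirror_form \<delta> A v" if v: "v \<in> ?K" for v
          using val[OF v] * eta_pos by (auto simp: zero_le_mult_iff)
        then show ?thesis by blast
      next
        assume *: "\<forall>(x::real) (y::real). in_base x y \<longrightarrow> m * y + n * x + tr * n * y + l \<le> 0"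
        have "mirror_form \<delta> A v \<le> 0" if v: "v \<in> ?K" for v
          using val[OF v] * eta_pos by (auto simp: mult_le_0_iff)
        then show ?thesis by blast
      qed
    qed
    moreover have "(0 \<le> \<phi> v \<longleftrightarrow> 0 \<le> s * mirror_form \<delta> A v) \<and> (\<phi> v \<le> 0 \<longleftrightarrow> 0 \<le> - s * mirror_form \<delta> A v)"
      if "v \<in> ?K" for v
      using mirror_sign(1)[OF A, of v s \<delta>] mirror_sign(1)[OF A, of v "- s" \<delta>] that K_H3 by (auto simp: \<phi>)
    ultimately show ?thesis using s by auto
  qed
  have complete: "w \<in> ?K" if w: "w \<in> H3" and nonneg: "\<forall>\<phi>\<in>mirrors. (\<forall>v\<in>?K. 0 \<le> \<phi> v) \<longrightarrow> 0 \<le> \<phi> w" for w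
  proof -
    obtain x y t where xyt: "w = (pt x y, t)" by (metis pt_surj surj_pair)
    \<comment> \<open>The mirror of the translation by \<open>- l\<close> tests the side of the line
      through \<open>l\<close> in direction \<open>\<delta>\<close>.\<close>
    have edge: "0 \<le> s * Im (cnj \<delta> * (pt x y - l))"
      if s: "s = 1 \<or> s = -1" and \<delta>: "\<delta> \<in> dirs" and l: "l \<in> Z_omega d"
        and base: "\<And>(x::real) (y::real). in_base x y \<Longrightarrow> 0 \<le> s * Im (cnj \<delta> * (pt x y - l))" for s \<delta> l
    proof -
      let ?\<phi> = "\<lambda>w. s * Im (cnj \<delta> * fst (moebius (mat2 1 (- l) 0 1) w))"
      have \<phi>: "?\<phi> \<in> mirrors" by (rule mirrorsI[OF s \<delta> translation_SL2[OF Z_omega_minus[OF l]]])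
      have val: "?\<phi> (z, u) = s * Im (cnj \<delta> * (z - l))" for z u by (simp add: moebius_translation)
      have "0 \<le> ?\<phi> v" if v: "v \<in> ?K" for v
      proof -
        obtain x y u where v': "v = (pt x y, u)" by (metis pt_surj surj_pair)
        have "in_base x y" using v unfolding v' by (rule K_base)
        then show ?thesis unfolding v' val by (rule base)
      qed
      then have "\<forall>v\<in>?K. 0 \<le> ?\<phi> v" by blast
      with bspec[OF nonneg \<phi>] have "0 \<le> ?\<phi> w" by (rule mp)
      then show ?thesis unfolding xyt val .
    qed
    have cnj_dirs: "cnj 1 = pt 1 0" "cnj (omega d) = pt tr (- 1)" "cnj (cnj (omega d)) = pt 0 1"
      by (simp_all add: pt_def cnj_omega)
    have Im_dirs: "Im (cnj 1 * (pt x y - pt x' y')) = \<eta> * (y - y')"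
      "Im (cnj (omega d) * (pt x y - pt x' y')) = - \<eta> * (x - x')"
      "Im (cnj (cnj (omega d)) * (pt x y - pt x' y')) = \<eta> * (x - x' + tr * (y - y'))" for x y x' y' :: real
      unfolding cnj_dirs(1,3) unfolding cnj_dirs(2) pt_diff pt_mult Im_pt by (simp_all add: algebra_simps)
    have dirs: "1 \<in> dirs" "omega d \<in> dirs" "cnj (omega d) \<in> dirs" by (simp_all add: dirs_def)
    have Z: "pt 0 0 \<in> Z_omega d" "pt 0 1 \<in> Z_omega d" "pt 1 0 \<in> Z_omega d"
      by (simp_all add: pt_def)
    note sgn = zero_le_mult_iff mult_le_0_iff
    have y0: "0 \<le> y"
      using edge[OF _ dirs(1) Z(1), of 1, unfolded Im_dirs] eta_pos by (simp add: sgn in_base_def)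
    have x0: "0 \<le> x"
      using edge[OF _ dirs(2) Z(1), of "-1", unfolded Im_dirs] eta_pos by (simp add: sgn in_base_def)
    have "in_base x y"
    proof (cases "tr = 0")
      case True
      have "y \<le> 1"
        using edge[OF _ dirs(1) Z(2), of "-1", unfolded Im_dirs] eta_pos True by (simp add: sgn in_base_def)
      moreover have "x \<le> 1"
        using edge[OF _ dirs(2) Z(3), of 1, unfolded Im_dirs] eta_pos True by (simp add: sgn in_base_def)
      ultimately show ?thesis using x0 y0 True by (simp add: in_base_def)
    next
      case False
      then have tr: "tr = 1" by (simp add: tr_def split: if_splits)
      have "x + y \<le> 1"
        using edge[OF _ dirs(3) Z(3), of "-1", unfolded Im_dirs] eta_pos tr by (simp add: sgn in_base_def)
      then show ?thesis using x0 y0 tr by (simp add: in_base_def)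
    qed
    then have "fst w \<in> base_polygon d" by (simp add: xyt base_polygon_iff)
    moreover have "0 \<le> lead \<delta> A * mirror_form \<delta> A w" if A: "A \<in> SL2 d" and \<delta>: "\<delta> \<in> dirs" for A \<delta>
    proof (cases "lead \<delta> A = 0")
      case False
      \<comment> \<open>This sign selects the mirror that is nonnegative outside the
        hemisphere.\<close>
      define s where "s = sgn (lead \<delta> A)"
      have s: "s = 1 \<or> s = -1" "lead \<delta> A = \<bar>lead \<delta> A\<bar> * s" using False by (auto simp: s_def sgn_if)
      have form: "0 \<le> lead \<delta> A * mirror_form \<delta> A v \<longleftrightarrow> 0 \<le> s * Im (cnj \<delta> * fst (moebius A v))" if "v \<in> H3" for v
        unfolding mirror_sign(1)[OF A that] using False by (subst s(2)) (simp add: zero_le_mult_iff mult.assoc)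
      have "\<forall>v\<in>?K. 0 \<le> s * Im (cnj \<delta> * fst (moebius A v))"
        using form K_H3 A \<delta> by (auto simp: std_cell_eq)
      with bspec[OF nonneg mirrorsI[OF s(1) \<delta> A]] have "0 \<le> s * Im (cnj \<delta> * fst (moebius A w))"
        by (rule mp)
      then show ?thesis using form[OF w] by simp
    qed simp
    ultimately show ?thesis using w by (simp add: std_cell_eq)
  qed
  show ?thesis unfolding mirror_cell_def using K_H3 sign complete by blast
qed

subsection \<open>Covering\<close>

lemma finite_Z_omega_bounded: "finite {x \<in> Z_omega d. cmod x \<le> R}"
proof -
  define a b where ab: "a = \<lceil>R / \<eta>\<rceil>" "b = \<lceil>R\<rceil> + a"
  have "{x \<in> Z_omega d. cmod x \<le> R} \<subseteq> (\<lambda>(m, n). pt (of_int m) (of_int n)) ` ({-b..b} \<times> {-a..a})"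
  proof
    fix x assume "x \<in> {x \<in> Z_omega d. cmod x \<le> R}"
    then obtain m n where x: "x = pt (of_int m) (of_int n)" and R: "cmod x \<le> R" by (auto simp: Z_omega_iff)
    have "\<bar>real_of_int n\<bar> * \<eta> \<le> R"
      using order_trans[OF abs_Im_le_cmod R] eta_pos by (simp add: x Im_pt abs_mult)
    then have "\<bar>real_of_int n\<bar> \<le> R / \<eta>" using eta_pos by (simp add: field_simps)
    then have n: "\<bar>n\<bar> \<le> a" unfolding ab by linarith
    have "\<bar>real_of_int m + n * tr / 2\<bar> \<le> R"
      using order_trans[OF abs_Re_le_cmod R] by (simp add: x Re_pt)
    moreover have "\<bar>n * tr / 2\<bar> \<le> real_of_int \<bar>n\<bar>" by (simp add: tr_def)
    ultimately have "real_of_int \<bar>m\<bar> \<le> R + real_of_int \<bar>n\<bar>" by linarith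
    then have "\<bar>m\<bar> \<le> b" using n unfolding ab(2) by linarith
    then show "x \<in> (\<lambda>(m, n). pt (of_int m) (of_int n)) ` ({-b..b} \<times> {-a..a})"
      using n by (auto simp: x abs_le_iff intro!: image_eqI[of _ _ "(m, n)"])
  qed
  then show ?thesis by (rule finite_subset) simp
qed

text \<open>Infinitely many matrices share a bottom row, so only the values are counted.
  \<open>mden\<close> depends on the bottom row \<open>(c, e)\<close> alone, and
  \<open>mden A w \<le> 1\<close> gives \<open>|c| \<le> 1 / t\<close> and
  \<open>|e| \<le> 1 + |z| / t\<close>.\<close>

lemma finite_small_mden:
  assumes w: "w \<in> H3"
  shows "finite {mden A w | A. A \<in> SL2 d \<and> mden A w \<le> 1}"
proof -
  obtain z t where zt: "w = (z, t)" "0 < t" using w by (cases w) (auto simp: H3_def)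
  define S where "S R = {x \<in> Z_omega d. cmod x \<le> R}" for R
  have "{mden A w | A. A \<in> SL2 d \<and> mden A w \<le> 1} \<subseteq>
      (\<lambda>(c, e). (cmod (c * z + e))\<^sup>2 + (cmod c)\<^sup>2 * t\<^sup>2) ` (S (1 / t) \<times> S (1 + cmod z / t))"
  proof clarify
    fix A assume A: "A \<in> SL2 d" "mden A w \<le> 1"
    define c e where ce: "c = A $ 2 $ 1" "e = A $ 2 $ 2"
    have m: "mden A w = (cmod (c * z + e))\<^sup>2 + (cmod c * t)\<^sup>2"
      by (simp add: mden_def ce zt power_mult_distrib)
    have le: "(cmod c * t)\<^sup>2 \<le> 1\<^sup>2" "(cmod (c * z + e))\<^sup>2 \<le> 1\<^sup>2"
      using A(2) zero_le_power2[of "cmod c * t"] zero_le_power2[of "cmod (c * z + e)"]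
      unfolding m one_power2 by linarith+
    have "cmod c * t \<le> 1" by (rule power2_le_imp_le[OF le(1)]) simp
    then have c: "cmod c \<le> 1 / t" using zt(2) by (simp add: field_simps)
    have e1: "cmod (c * z + e) \<le> 1" by (rule power2_le_imp_le[OF le(2)]) simp
    have "cmod e \<le> cmod (c * z + e) + cmod (c * z)"
      using norm_triangle_ineq4[of "c * z + e" "c * z"] by simp
    also have "\<dots> \<le> 1 + cmod z / t"
      using e1 mult_right_mono[OF c, of "cmod z"] by (simp add: norm_mult)
    finally have "e \<in> S (1 + cmod z / t)" using A(1) by (simp add: S_def ce SL2_iff)
    moreover have "c \<in> S (1 / t)" using c A(1) by (simp add: S_def ce SL2_iff)
    ultimately show "mden A w \<in> (\<lambda>(c, e). (cmod (c * z + e))\<^sup>2 + (cmod c)\<^sup>2 * t\<^sup>2) ` (S (1 / t) \<times> S (1 + cmod z / t))"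
      unfolding m by (auto simp: power_mult_distrib intro!: image_eqI[of _ _ "(c, e)"])
  qed
  then show ?thesis by (rule finite_subset) (simp add: S_def finite_Z_omega_bounded)
qed

text \<open>The cocycle relation, read off by computing the height of \<open>B (A w)\<close> in two
  ways.\<close>

lemma mden_mult:
  assumes A: "A \<in> SL2 d" and B: "B \<in> SL2 d" and w: "w \<in> H3"
  shows "mden (B ** A) w = mden A w * mden B (moebius A w)"
proof -
  obtain z t where zt: "w = (z, t)" "0 < t" using w by (cases w) (auto simp: H3_def)
  obtain z' t' where zt': "moebius A w = (z', t')" by fastforce
  have pos: "0 < mden A w" "0 < mden (B ** A) w" "0 < mden B (moebius A w)"
    by (intro mden_pos SL2_det SL2_mult A B w moebius_H3)+
  have "t / mden (B ** A) w = snd (moebius (B ** A) w)"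
    unfolding zt(1) by (simp add: snd_moebius SL2_det SL2_mult A B)
  also have "\<dots> = t' / mden B (moebius A w)"
    by (simp add: moebius_mult SL2_det A B w zt' snd_moebius)
  also have "t' = t / mden A w"
    using snd_moebius[OF SL2_det[OF A], of z t] zt' by (simp add: zt(1))
  finally show ?thesis using pos zt(2) by (simp add: field_simps)
qed

text \<open>Minimal \<open>mden\<close> means maximal height in the orbit. The matrix with rows
  \<open>(0, -1)\<close> and \<open>(1, -l)\<close> has \<open>mden\<close> equal to
  \<open>|z - l|^2 + t^2\<close>, so maximality forces this to be at least 1.\<close>

lemma ford_representative:
  assumes w: "w \<in> H3"
  obtains A where "A \<in> SL2 d"
    "\<And>l. l \<in> Z_omega d \<Longrightarrow> 1 \<le> (cmod (fst (moebius A w) - l))\<^sup>2 + (snd (moebius A w))\<^sup>2"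
proof -
  let ?M = "{mden A w | A. A \<in> SL2 d \<and> mden A w \<le> 1}"
  have one: "mat 1 \<in> SL2 d" by (simp add: SL2_iff mat_def)
  have "mden (mat 1) w = 1" by (simp add: mden_def mat_def)
  then have ne: "?M \<noteq> {}" using one by force
  have fin: "finite ?M" by (rule finite_small_mden[OF w])
  obtain A where A: "A \<in> SL2 d" "mden A w \<le> 1" "mden A w = Min ?M" using Min_in[OF fin ne] by auto
  have min: "mden A w \<le> mden B w" if "B \<in> SL2 d" for B
  proof (cases "mden B w \<le> 1")
    case True
    then have "mden B w \<in> ?M" using that by blast
    then show ?thesis unfolding A(3) using fin by (rule Min_le[rotated])
  qed (use A(2) in simp)
  have "1 \<le> (cmod (fst (moebius A w) - l))\<^sup>2 + (snd (moebius A w))\<^sup>2" if l: "l \<in> Z_omega d" for l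
  proof -
    have B: "mat2 0 (- 1) 1 (- l) \<in> SL2 d" using l by (simp add: SL2_iff Z_omega_minus)
    have "mden A w * 1 \<le> mden A w * mden (mat2 0 (- 1) 1 (- l)) (moebius A w)"
      using min[OF SL2_mult[OF B A(1)]] by (simp add: mden_mult[OF A(1) B w])
    moreover have "0 < mden A w" by (rule mden_pos[OF SL2_det[OF A(1)] w])
    ultimately have "1 \<le> mden (mat2 0 (- 1) 1 (- l)) (moebius A w)" by (simp only: mult_le_cancel_left_pos)
    then show ?thesis by (simp add: mden_def)
  qed
  then show ?thesis using that A(1) by blast
qed

lemma ford_in_std_cell:
  assumes t: "0 < t" and W: "in_base x y"
    and ford: "\<And>l. l \<in> Z_omega d \<Longrightarrow> 1 \<le> (cmod (pt x y - l))\<^sup>2 + t\<^sup>2"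
  shows "(pt x y, t) \<in> std_cell d"
proof -
  have ford': "1 \<le> qf (x - a) (y - b) + t\<^sup>2" for a b :: int
    using ford[of "pt (of_int a) (of_int b)"] by (simp add: pt_diff cmod_pt qf_def)
  have "0 \<le> lead \<delta> A * mirror_form \<delta> A (pt x y, t)" if A: "A \<in> SL2 d" and \<delta>: "\<delta> \<in> dirs" for A \<delta>
  proof -
    obtain j m n l N :: int where j: "lead \<delta> A = \<eta> * j" and N: "N = 1 \<or> N = nm"
      and disc: "m\<^sup>2 + tr * m * n + nm * n\<^sup>2 - disc * j * l = N"
      and form: "\<And>(x::real) (y::real) t. 0 < t \<Longrightarrow> mirror_form \<delta> A (pt x y, t) =
        \<eta> * (j * (qf x y + t\<^sup>2) + (m * y + n * x + tr * n * y) + l)"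
      using mirror_form_coords[OF A \<delta>] by metis
    have "0 \<le> j * (j * (qf x y + t\<^sup>2) + (m * y + n * x + tr * n * y) + l)"
      using form_nonneg_ford[OF W ford' disc N] by (cases "j = 0") simp_all
    then have "0 \<le> \<eta>\<^sup>2 * (j * (j * (qf x y + t\<^sup>2) + (m * y + n * x + tr * n * y) + l))"
      by (rule mult_nonneg_nonneg[OF zero_le_power2])
    also have "\<dots> = lead \<delta> A * mirror_form \<delta> A (pt x y, t)"
      unfolding j form[OF t] by (simp add: power2_eq_square mult_ac)
    finally show ?thesis .
  qed
  then show ?thesis using t W by (simp add: std_cell_eq H3_def base_polygon_iff)
qed

text \<open>Rounding down moves the point into the parallelogram spanned by 1 and
  \<open>omega d\<close>. In the triangular case its upper half, shifted down by
  \<open>omega d\<close>, is the conjugate of the base triangle.\<close>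

lemma translate_to_base:
  obtains l where "l \<in> Z_omega d" "z - l \<in> base_polygon d \<or> (d \<notin> {1, 2} \<and> cnj (z - l) \<in> base_polygon d)"
proof -
  obtain x y where z: "z = pt x y" by (rule pt_surj)
  define a b where ab: "a = \<lfloor>x\<rfloor>" "b = \<lfloor>y\<rfloor>"
  have xy: "0 \<le> x - a" "x - a \<le> 1" "0 \<le> y - b" "y - b \<le> 1" unfolding ab by linarith+
  consider "in_base (x - a) (y - b)" | "tr = 1" "1 \<le> (x - a) + (y - b)"
  proof (cases "tr = 0")
    case True
    then show ?thesis using xy that(1) by (simp add: in_base_def)
  next
    case False
    then have "tr = 1" by (simp add: tr_def split: if_splits)
    then show ?thesis
      using xy that by (cases "1 \<le> (x - a) + (y - b)") (simp_all add: in_base_def)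
  qed
  then show ?thesis
  proof cases
    case 1
    then show ?thesis
      using that[of "pt (of_int a) (of_int b)"] by (simp add: z pt_diff base_polygon_iff)
  next
    case 2
    have "cnj (z - pt (of_int a) (of_int (b + 1))) = pt ((x - a) + (y - b) - 1) (1 - (y - b))"
      using 2(1) by (simp add: z pt_diff cnj_pt algebra_simps)
    moreover have "in_base ((x - a) + (y - b) - 1) (1 - (y - b))" using 2 xy by (simp add: in_base_def)
    moreover have "d \<notin> {1, 2}" using 2(1) by (auto simp: tr_def)
    ultimately show ?thesis
      using that[of "pt (of_int a) (of_int (b + 1))"] pt_Z_omega base_polygon_iff by metis
  qed
qed

lemma cells_cover:
  assumes w: "w \<in> H3"
  obtains A where "A \<in> SL2 d" "moebius A w \<in> std_cell d \<or> (d \<notin> {1, 2} \<and> moebius A w \<in> conj_cell d)"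
proof -
  obtain A where A: "A \<in> SL2 d"
    and ford: "\<And>l. l \<in> Z_omega d \<Longrightarrow> 1 \<le> (cmod (fst (moebius A w) - l))\<^sup>2 + (snd (moebius A w))\<^sup>2"
    using ford_representative[OF w] by blast
  obtain z t where zt: "moebius A w = (z, t)" by fastforce
  have t: "0 < t" using moebius_H3[OF A w] by (simp add: zt H3_def)
  obtain l where l: "l \<in> Z_omega d" "z - l \<in> base_polygon d \<or> (d \<notin> {1, 2} \<and> cnj (z - l) \<in> base_polygon d)"
    by (rule translate_to_base)
  have T: "mat2 1 (- l) 0 1 \<in> SL2 d" using l(1) by (intro translation_SL2 Z_omega_minus)
  have TA: "moebius (mat2 1 (- l) 0 1 ** A) w = (z - l, t)"
    by (simp add: moebius_mult SL2_det T A w zt moebius_translation)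
  \<comment> \<open>The lattice is stable under translation by its elements and under conjugation,
    so the point stays outside all unit balls.\<close>
  have ford1: "1 \<le> (cmod (z - l - k))\<^sup>2 + t\<^sup>2" if "k \<in> Z_omega d" for k
    using ford[OF Z_omega_add[OF l(1) that]] by (simp add: zt diff_diff_eq)
  have ford2: "1 \<le> (cmod (cnj (z - l) - k))\<^sup>2 + t\<^sup>2" if "k \<in> Z_omega d" for k
    using ford1[OF Z_omega_cnj[OF that]] complex_mod_cnj[of "z - l - cnj k"] by simp
  have std: "(v, t) \<in> std_cell d" if "v \<in> base_polygon d" "\<And>k. k \<in> Z_omega d \<Longrightarrow> 1 \<le> (cmod (v - k))\<^sup>2 + t\<^sup>2" for v
  proof -
    obtain x y where v: "v = pt x y" by (rule pt_surj)
    show ?thesis unfolding v by (rule ford_in_std_cell[OF t]) (use that in \<open>auto simp: v base_polygon_iff\<close>)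
  qed
  have "(z - l, t) \<in> std_cell d \<or> (d \<notin> {1, 2} \<and> (z - l, t) \<in> conj_cell d)"
    using l(2)
  proof
    assume "z - l \<in> base_polygon d"
    then show ?thesis using std ford1 by blast
  next
    assume *: "d \<notin> {1, 2} \<and> cnj (z - l) \<in> base_polygon d"
    then have "(cnj (z - l), t) \<in> std_cell d" using std ford2 by blast
    then have "(z - l, t) \<in> conj_cell d" unfolding conj_cell_def by (rule image_eqI[rotated]) simp
    then show ?thesis using * by blast
  qed
  then show ?thesis using that[OF SL2_mult[OF T A]] by (simp only: TA)
qed

section \<open>Orbits of cells\<close>

lemma mirror_cell_psl_act:
  assumes "P \<in> PSL2 d" and K: "mirror_cell mirrors K"
  shows "mirror_cell mirrors (psl_act P ` K)"
proof -
  obtain A where A: "A \<in> SL2 d" "P = {A, - A}" using assms(1) by (auto simp: PSL2_eq)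
  obtain B where B: "B \<in> SL2 d" "A ** B = mat 1" "B ** A = mat 1" using SL2_inverse[OF A(1)] by blast
  have "mirror_cell mirrors (moebius A ` K)"
    using K
  proof (rule mirror_cell_image[where h = "moebius B"])
    show "\<And>w. w \<in> H3 \<Longrightarrow> moebius A w \<in> H3" "\<And>w. w \<in> H3 \<Longrightarrow> moebius B w \<in> H3"
      by (simp_all add: moebius_H3 A B)
    show "\<And>w. w \<in> H3 \<Longrightarrow> moebius B (moebius A w) = w" "\<And>w. w \<in> H3 \<Longrightarrow> moebius A (moebius B w) = w"
      using moebius_inverse A(1) B by blast+
  qed (rule mirrors_moebius; use A B in simp)+
  then show ?thesis by (simp add: A(2) psl_act_class)
qed

lemma conj_cell_mirror_cell: "mirror_cell mirrors (conj_cell d)"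
  unfolding conj_cell_def conj_pt_def[symmetric]
  by (rule mirror_cell_image[OF std_cell_mirror_cell, where h = conj_pt])
    (simp_all add: conj_pt_H3 conj_pt_conj_pt mirrors_conj)

text \<open>If the interiors of two members meet, \<open>mirror_cell_subset\<close> in both
  directions makes the members equal.\<close>

lemma tessellation_mirror_cells:
  assumes cells: "\<And>S. S \<in> \<T> \<Longrightarrow> mirror_cell mirrors S" and cover: "H3 \<subseteq> \<Union>\<T>"
  shows "tessellation \<T>"
  unfolding tessellation_def
proof (intro conjI ballI)
  fix S assume "S \<in> \<T>"
  then show "closedin (top_of_set H3) S"
    using mirror_cell_closedin[OF cells mirrors_closedin] by blast
next
  show "\<Union>\<T> = H3" using cover cells unfolding mirror_cell_def by blast
next
  fix S T assume ST: "S \<in> \<T>" "T \<in> \<T>"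
  show "top_of_set H3 interior_of S = top_of_set H3 interior_of T \<or>
      disjnt (top_of_set H3 interior_of S) (top_of_set H3 interior_of T)"
  proof (cases "disjnt (top_of_set H3 interior_of S) (top_of_set H3 interior_of T)")
    case False
    then obtain w where w: "w \<in> top_of_set H3 interior_of S" "w \<in> top_of_set H3 interior_of T"
      by (auto simp: disjnt_def)
    have "S \<subseteq> T" by (rule mirror_cell_subset[OF cells cells mirrors_cross w]) (use ST in auto)
    moreover have "T \<subseteq> S" by (rule mirror_cell_subset[OF cells cells mirrors_cross w(2,1)]) (use ST in auto)
    ultimately show ?thesis by auto
  qed simp
qed

lemma psl_cover:
  assumes w: "w \<in> H3"
  obtains P where "P \<in> PSL2 d" "w \<in> psl_act P ` std_cell d \<or> (d \<notin> {1, 2} \<and> w \<in> psl_act P ` conj_cell d)"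
proof -
  obtain A where A: "A \<in> SL2 d" and cell: "moebius A w \<in> std_cell d \<or> (d \<notin> {1, 2} \<and> moebius A w \<in> conj_cell d)"
    by (rule cells_cover[OF w])
  obtain B where B: "B \<in> SL2 d" "A ** B = mat 1" "B ** A = mat 1" using SL2_inverse[OF A] by blast
  have "w = psl_act {B, - B} (moebius A w)"
    unfolding psl_act_class using moebius_inverse[OF B(1) A B(3) w] by simp
  moreover have "{B, - B} \<in> PSL2 d" using B(1) by (auto simp: PSL2_eq)
  ultimately show ?thesis using cell that by blast
qed

end

theorem theorem4:
  fixes d :: nat
  shows "(d \<in> {1, 2} \<longrightarrow> tessellation {psl_act P ` std_cell d | P. P \<in> PSL2 d}) \<and>
    (d \<in> {3, 7, 11} \<longrightarrow>
      tessellation ({psl_act P ` std_cell d | P. P \<in> PSL2 d} \<union>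
                    {psl_act P ` conj_cell d | P. P \<in> PSL2 d}))"
proof (intro conjI impI)
  assume dd: "d \<in> {1, 2}"
  then interpret bianchi d by unfold_locales auto
  show "tessellation {psl_act P ` std_cell d | P. P \<in> PSL2 d}"
  proof (rule tessellation_mirror_cells)
    show "H3 \<subseteq> \<Union>{psl_act P ` std_cell d | P. P \<in> PSL2 d}"
    proof
      fix w assume "w \<in> H3"
      then obtain P where "P \<in> PSL2 d" "w \<in> psl_act P ` std_cell d"
        by (rule psl_cover) (use dd in blast)
      then show "w \<in> \<Union>{psl_act P ` std_cell d | P. P \<in> PSL2 d}" by blast
    qed
  qed (auto intro: mirror_cell_psl_act std_cell_mirror_cell)
next
  assume dd: "d \<in> {3, 7, 11}"
  then interpret bianchi d by unfold_locales auto
  show "tessellation ({psl_act P ` std_cell d | P. P \<in> PSL2 d} \<union> {psl_act P ` conj_cell d | P. P \<in> PSL2 d})"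
  proof (rule tessellation_mirror_cells)
    show "H3 \<subseteq> \<Union>({psl_act P ` std_cell d | P. P \<in> PSL2 d} \<union> {psl_act P ` conj_cell d | P. P \<in> PSL2 d})"
    proof
      fix w assume "w \<in> H3"
      then obtain P where "P \<in> PSL2 d" "w \<in> psl_act P ` std_cell d \<or> w \<in> psl_act P ` conj_cell d"
        by (rule psl_cover) blast
      then show "w \<in> \<Union>({psl_act P ` std_cell d | P. P \<in> PSL2 d} \<union> {psl_act P ` conj_cell d | P. P \<in> PSL2 d})"
        by blast
    qed
  qed (auto intro: mirror_cell_psl_act std_cell_mirror_cell conj_cell_mirror_cell)
qed

end
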